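(* Let $\mathbb{A}$ be a commutative ring with unit, $\mathfrak{m}\subset\mathbb{A}$ an ideal, and $Q$ a rack. Consider the Yang-Baxter cochain complex $(C^n,d^n)_{n\ge1}$ of $c_Q\colon\mathbb{A}Q^2\to\mathbb{A}Q^2$, $x\otimes y\mapsto y\otimes(x\ast y)$, with cocycles $Z^n$ and coboundaries $B^n$. Then the entropic $n$-cochains form a submodule of $Z^n$, denoted $E^n$. If the order of $\operatorname{Inn}(Q)$ is invertible in $\mathbb{A}$, then $Z^2=E^2\oplus B^2$; in other words, every $2$-cocycle is cohomologous to exactly one entropic cocycle.
   Context: A rack is a set $Q$ with a binary operation $(x,y)\mapsto x\ast y=x^y$ such that every right translation $\varrho(y)\colon x\mapsto x\ast y$ is a bijection of $Q$ and $(x\ast y)\ast z=(x\ast z)\ast(y\ast z)$ for all $x,y,z$. $\operatorname{Inn}(Q)$ is the group of automorphisms of $Q$ generated by all $\varrho(y)$, $y\in Q$. $V=\mathbb{A}Q$ is the free $\mathbb{A}$-module with basis $Q$; tensor products are over $\mathbb{A}$; $\mathbb{A}Q^n$ is identified with $V^{\otimes n}$ and $\mathfrak{m}Q^n=\mathfrak{m}V^{\otimes n}$; $\mathrm{I}$ is the identity of $V$. Yang-Baxter cochain complex of $c=c_Q$ (with respect to $\mathfrak{m}$): $C^n=\operatorname{Hom}_{\mathbb{A}}(V^{\otimes n},\mathfrak{m}V^{\otimes n})$ for $n\ge1$; for $f\in C^n$ and $0\le i\le n$ define $d^n_if\in C^{n+1}$ by $$d^n_if=(c_n\cdots c_{i+1})^{-1}(f\otimes\mathrm{I})(c_n\cdots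 c_{i+1})-(c_1\cdots c_i)^{-1}(\mathrm{I}\otimes f)(c_1\cdots c_i),$$ where $c_j=\mathrm{I}^{\otimes(j-1)}\otimes c\otimes\mathrm{I}^{\otimes(n-j)}$ acts on $V^{\otimes(n+1)}$ and products are compositions (rightmost applied first); $d^n=\sum_{i=0}^n(-1)^id^n_i\colon C^n\to C^{n+1}$. Put $Z^n=\ker d^n$, $B^n=\operatorname{im}d^{n-1}$ (with $B^1=0$); cocycles are cohomologous if they differ by an element of $B^n$. A cochain $f\in C^n$ is entropic if $d^n_if=0$ for every $i=0,\dots,n$. *)

theory Defs
  imports
    "HOL-Library.Poly_Mapping"
    "HOL-Library.Function_Algebras"
    "HOL-Algebra.Bij"
    "HOL-Algebra.Generated_Groups"
begin

text \<open>
  The ground ring is a type of sort \<open>{comm_ring, comm_monoid_mult}\<close>. This is precisely a commutative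
  ring with unit; the class \<open>comm_ring_1\<close> would in addition exclude the zero ring.
\<close>


section \<open>Racks and their inner automorphism groups\<close>

definition rack :: "'q set \<Rightarrow> ('q \<Rightarrow> 'q \<Rightarrow> 'q) \<Rightarrow> bool" where
  "rack Q op \<longleftrightarrow>
     (\<forall>y\<in>Q. bij_betw (\<lambda>x. op x y) Q Q) \<and>
     (\<forall>x\<in>Q. \<forall>y\<in>Q. \<forall>z\<in>Q. op (op x y) z = op (op x z) (op y z))"

definition rack_Aut :: "'q set \<Rightarrow> ('q \<Rightarrow> 'q \<Rightarrow> 'q) \<Rightarrow> ('q \<Rightarrow> 'q) monoid" where
  "rack_Aut Q op =
     BijGroup Q \<lparr>carrier := {\<phi> \<in> Bij Q. \<forall>x\<in>Q. \<forall>y\<in>Q. \<phi> (op x y) = op (\<phi> x) (\<phi> y)}\<rparr>"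

definition right_translation :: "'q set \<Rightarrow> ('q \<Rightarrow> 'q \<Rightarrow> 'q) \<Rightarrow> 'q \<Rightarrow> 'q \<Rightarrow> 'q" where
  "right_translation Q op y = (\<lambda>x\<in>Q. op x y)"

definition Inn :: "'q set \<Rightarrow> ('q \<Rightarrow> 'q \<Rightarrow> 'q) \<Rightarrow> ('q \<Rightarrow> 'q) monoid" where
  "Inn Q op = subgroup_generated (rack_Aut Q op) (right_translation Q op ` Q)"

text \<open>
  Invertibility of the image of a natural number in the ring; \<open>of_nat\<close> is not available without
  \<open>0 \<noteq> 1\<close>. Finiteness has to be required separately, because \<open>order\<close> is \<open>0\<close> for infinite groups.
\<close>

definition order_invertible ::
    "('g, 'b) monoid_scheme \<Rightarrow> 'a::{comm_ring,comm_monoid_mult} itself \<Rightarrow> bool" where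
  "order_invertible G TYPE('a) \<longleftrightarrow>
     finite (carrier G) \<and> (\<exists>u::'a. (\<Sum>i<order G. 1) * u = 1)"


section \<open>Ideals, submodules and free modules\<close>

definition ring_ideal :: "'a::{comm_ring,comm_monoid_mult} set \<Rightarrow> bool" where
  "ring_ideal I \<longleftrightarrow> 0 \<in> I \<and> (\<forall>a\<in>I. \<forall>b\<in>I. a + b \<in> I) \<and> (\<forall>r. \<forall>a\<in>I. r * a \<in> I)"

text \<open>
  Elements of \<open>V\<^sup>\<otimes>\<^sup>n = \<bbbA>Q\<^sup>n\<close> are finitely supported functions on words of length \<open>n\<close> in \<open>Q\<close>;
  the word \<open>[x\<^sub>1, \<dots>, x\<^sub>n]\<close> stands for the basis vector \<open>x\<^sub>1 \<otimes> \<dots> \<otimes> x\<^sub>n\<close>.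
\<close>

type_synonym ('q, 'a) tensor = "'q list \<Rightarrow>\<^sub>0 'a"

definition words :: "'q set \<Rightarrow> nat \<Rightarrow> 'q list set" where
  "words Q n = {w. length w = n \<and> set w \<subseteq> Q}"

text \<open>
  \<open>tensors \<mm> Q n\<close> is \<open>\<mm>Q\<^sup>n = \<mm>V\<^sup>\<otimes>\<^sup>n\<close>, and \<open>tensors UNIV Q n\<close> is \<open>\<bbbA>Q\<^sup>n = V\<^sup>\<otimes>\<^sup>n\<close>.
\<close>

definition tensors :: "'a::{comm_ring,comm_monoid_mult} set \<Rightarrow> 'q set \<Rightarrow> nat \<Rightarrow> ('q, 'a) tensor set" where
  "tensors I Q n =
     {v. Poly_Mapping.keys v \<subseteq> words Q n \<and> (\<forall>w. Poly_Mapping.lookup v w \<in> I)}"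

definition basis :: "'q list \<Rightarrow> ('q, 'a::{comm_ring,comm_monoid_mult}) tensor" where
  "basis w = Poly_Mapping.single w 1"

definition scale ::
    "'a::{comm_ring,comm_monoid_mult} \<Rightarrow> ('q, 'a) tensor \<Rightarrow> ('q, 'a) tensor" where
  "scale a v = Poly_Mapping.map ((*) a) v"

definition lin_ext ::
    "('q list \<Rightarrow> ('q, 'a) tensor) \<Rightarrow> ('q, 'a::{comm_ring,comm_monoid_mult}) tensor \<Rightarrow> ('q, 'a) tensor" where
  "lin_ext \<phi> v = (\<Sum>w\<in>Poly_Mapping.keys v. scale (Poly_Mapping.lookup v w) (\<phi> w))"

definition tensor_prod ::
    "('q, 'a::{comm_ring,comm_monoid_mult}) tensor \<Rightarrow> ('q, 'a) tensor \<Rightarrow> ('q, 'a) tensor" where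
  "tensor_prod u v = lin_ext (\<lambda>x. lin_ext (\<lambda>y. basis (x @ y)) v) u"

text \<open>
  The tensor product \<open>f \<otimes> g\<close> of linear maps, where \<open>f\<close> acts on the first \<open>k\<close> tensor factors and
  \<open>g\<close> on all the remaining ones.
\<close>

definition tensor_map ::
    "nat \<Rightarrow> (('q, 'a) tensor \<Rightarrow> ('q, 'a) tensor) \<Rightarrow> (('q, 'a) tensor \<Rightarrow> ('q, 'a) tensor) \<Rightarrow>
     ('q, 'a::{comm_ring,comm_monoid_mult}) tensor \<Rightarrow> ('q, 'a) tensor" where
  "tensor_map k f g = lin_ext (\<lambda>w. tensor_prod (f (basis (take k w))) (g (basis (drop k w))))"


section \<open>The Yang-Baxter cochain complex\<close>

definition braiding ::
    "('q \<Rightarrow> 'q \<Rightarrow> 'q) \<Rightarrow> ('q, 'a::{comm_ring,comm_monoid_mult}) tensor \<Rightarrow> ('q, 'a) tensor" where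
  "braiding op = lin_ext (\<lambda>w. basis [w ! 1, op (w ! 0) (w ! 1)])"

text \<open>
  \<open>braiding_at op j\<close> is \<open>c\<^sub>j = I\<^sup>\<otimes>\<^sup>(\<^sup>j\<^sup>-\<^sup>1\<^sup>) \<otimes> c \<otimes> I\<^sup>\<otimes>\<^sup>(\<^sup>n\<^sup>-\<^sup>j\<^sup>)\<close> for \<open>j \<ge> 1\<close>.
\<close>

definition braiding_at ::
    "('q \<Rightarrow> 'q \<Rightarrow> 'q) \<Rightarrow> nat \<Rightarrow> ('q, 'a::{comm_ring,comm_monoid_mult}) tensor \<Rightarrow> ('q, 'a) tensor" where
  "braiding_at op j = tensor_map (j - 1) id (tensor_map 2 (braiding op) id)"

text \<open>\<open>right_braid op n i = c\<^sub>n \<circ> \<dots> \<circ> c\<^bsub>i+1\<^esub>\<close> and \<open>left_braid op i = c\<^sub>1 \<circ> \<dots> \<circ> c\<^sub>i\<close>.\<close>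

definition right_braid ::
    "('q \<Rightarrow> 'q \<Rightarrow> 'q) \<Rightarrow> nat \<Rightarrow> nat \<Rightarrow>
     ('q, 'a::{comm_ring,comm_monoid_mult}) tensor \<Rightarrow> ('q, 'a) tensor" where
  "right_braid op n i = foldr (\<circ>) (map (braiding_at op) (rev [Suc i..<Suc n])) id"

definition left_braid ::
    "('q \<Rightarrow> 'q \<Rightarrow> 'q) \<Rightarrow> nat \<Rightarrow> ('q, 'a::{comm_ring,comm_monoid_mult}) tensor \<Rightarrow> ('q, 'a) tensor" where
  "left_braid op i = foldr (\<circ>) (map (braiding_at op) [1..<Suc i]) id"

text \<open>
  A linear map defined on \<open>V\<^sup>\<otimes>\<^sup>n\<close> only is represented by the function that is \<open>0\<close> outside
  \<open>V\<^sup>\<otimes>\<^sup>n\<close>. This makes the representation unique, and zero, sums and multiples of cochains become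
  the pointwise ones.
\<close>

type_synonym ('q, 'a) cochain = "('q, 'a) tensor \<Rightarrow> ('q, 'a) tensor"

definition cochains ::
    "'a::{comm_ring,comm_monoid_mult} set \<Rightarrow> 'q set \<Rightarrow> nat \<Rightarrow> ('q, 'a) cochain set" where
  "cochains \<mm> Q n =
     {f. (\<forall>v. v \<notin> tensors UNIV Q n \<longrightarrow> f v = 0) \<and>
         (\<forall>v\<in>tensors UNIV Q n. f v \<in> tensors \<mm> Q n) \<and>
         (\<forall>u\<in>tensors UNIV Q n. \<forall>v\<in>tensors UNIV Q n. f (u + v) = f u + f v) \<and>
         (\<forall>a. \<forall>v\<in>tensors UNIV Q n. f (scale a v) = scale a (f v))}"

definition cochain_scale ::
    "'a::{comm_ring,comm_monoid_mult} \<Rightarrow> ('q, 'a) cochain \<Rightarrow> ('q, 'a) cochain" where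
  "cochain_scale a f = (\<lambda>v. scale a (f v))"

definition partial_coboundary ::
    "'q set \<Rightarrow> ('q \<Rightarrow> 'q \<Rightarrow> 'q) \<Rightarrow> nat \<Rightarrow> nat \<Rightarrow>
     ('q, 'a::{comm_ring,comm_monoid_mult}) cochain \<Rightarrow> ('q, 'a) cochain" where
  "partial_coboundary Q op n i f = (\<lambda>v.
     if v \<in> tensors UNIV Q (Suc n) then
       the_inv_into (tensors UNIV Q (Suc n)) (right_braid op n i)
         (tensor_map n f id (right_braid op n i v))
       - the_inv_into (tensors UNIV Q (Suc n)) (left_braid op i)
         (tensor_map 1 id f (left_braid op i v))
     else 0)"

definition coboundary ::
    "'q set \<Rightarrow> ('q \<Rightarrow> 'q \<Rightarrow> 'q) \<Rightarrow> nat \<Rightarrow>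
     ('q, 'a::{comm_ring,comm_monoid_mult}) cochain \<Rightarrow> ('q, 'a) cochain" where
  "coboundary Q op n f =
     (\<Sum>i\<le>n. cochain_scale ((- 1) ^ i) (partial_coboundary Q op n i f))"

definition cocycles ::
    "'a::{comm_ring,comm_monoid_mult} set \<Rightarrow> 'q set \<Rightarrow> ('q \<Rightarrow> 'q \<Rightarrow> 'q) \<Rightarrow> nat \<Rightarrow> ('q, 'a) cochain set" where
  "cocycles \<mm> Q op n = {f \<in> cochains \<mm> Q n. coboundary Q op n f = 0}"

text \<open>The complex starts in degree 1.\<close>

definition coboundaries ::
    "'a::{comm_ring,comm_monoid_mult} set \<Rightarrow> 'q set \<Rightarrow> ('q \<Rightarrow> 'q \<Rightarrow> 'q) \<Rightarrow> nat \<Rightarrow> ('q, 'a) cochain set" where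
  "coboundaries \<mm> Q op n =
     (if n \<le> 1 then {0} else coboundary Q op (n - 1) ` cochains \<mm> Q (n - 1))"

definition cohomologous ::
    "'a::{comm_ring,comm_monoid_mult} set \<Rightarrow> 'q set \<Rightarrow> ('q \<Rightarrow> 'q \<Rightarrow> 'q) \<Rightarrow> nat \<Rightarrow>
     ('q, 'a) cochain \<Rightarrow> ('q, 'a) cochain \<Rightarrow> bool" where
  "cohomologous \<mm> Q op n f g \<longleftrightarrow> f - g \<in> coboundaries \<mm> Q op n"

definition entropic_cochains ::
    "'a::{comm_ring,comm_monoid_mult} set \<Rightarrow> 'q set \<Rightarrow> ('q \<Rightarrow> 'q \<Rightarrow> 'q) \<Rightarrow> nat \<Rightarrow> ('q, 'a) cochain set" where
  "entropic_cochains \<mm> Q op n =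
     {f \<in> cochains \<mm> Q n. \<forall>i\<le>n. partial_coboundary Q op n i f = 0}"

definition cochain_submodule ::
    "('q, 'a::{comm_ring,comm_monoid_mult}) cochain set \<Rightarrow> ('q, 'a) cochain set \<Rightarrow> bool" where
  "cochain_submodule S M \<longleftrightarrow>
     S \<subseteq> M \<and> 0 \<in> S \<and> (\<forall>f\<in>S. \<forall>g\<in>S. f + g \<in> S) \<and> (\<forall>a. \<forall>f\<in>S. cochain_scale a f \<in> S)"

definition cochain_direct_sum ::
    "('q, 'a::{comm_ring,comm_monoid_mult}) cochain set \<Rightarrow> ('q, 'a) cochain set \<Rightarrow>
     ('q, 'a) cochain set \<Rightarrow> bool" where
  "cochain_direct_sum M S T \<longleftrightarrow>
     cochain_submodule S M \<and> cochain_submodule T M \<and>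
     M = {f + g |f g. f \<in> S \<and> g \<in> T} \<and> S \<inter> T = {0}"

end

theory Submission
  imports Defs "HOL-Algebra.Multiplicative_Group"
begin

text \<open>
  Write \<open>x\<^sup>y\<close> for \<open>op x y\<close>, and \<open>f[x;y]\<close> for the coefficient of the word \<open>y\<close> in the image under \<open>f\<close> of
  the word \<open>x\<close>. Braiding a letter to either end of a word permutes the basis, so conjugation with it
  only relabels coefficients: for words \<open>p a q\<close> and \<open>p' a' q'\<close>, where \<open>a\<close> and \<open>a'\<close> are the \<open>i\<close>-th
  letters counted from \<open>0\<close>, the coefficient of the \<open>i\<close>-th partial coboundary of \<open>f\<close> is
  \<open>f[pq;p'q']\<close> if \<open>a\<^sup>q = a'\<^sup>q\<^sup>'\<close>, minus \<open>f[p\<^sup>aq;p'\<^sup>a\<^sup>'q']\<close> if \<open>a = a'\<close> (lemma \<open>coef_partial_coboundary\<close>).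
  Everything is a computation with this formula. It is linear in \<open>f\<close>, so entropic cochains form a
  submodule, and they are cocycles because the coboundary is the alternating sum of the partial ones.

  In degree two there are three ideas.

  Freezing the last letter, \<open>k[x;u] = f[x z;u z]\<close>, is a chain homotopy which shows that the right
  translation by \<open>z\<close> changes a cocycle \<open>f\<close> only by a coboundary; hence so does every inner
  automorphism. As the order of \<open>Inn(Q)\<close> is invertible, averaging over \<open>Inn(Q)\<close> makes every cocycle
  cohomologous to an invariant one (lemma \<open>cohomologous_invariant\<close>).

  For an invariant cocycle the last partial coboundary vanishes, and the cocycle equation says that
  the first two agree. Compare two last letters \<open>z\<close> and \<open>w\<close>. If they act on \<open>Q\<close> in the same way, the
  equation splits and both partial coboundaries vanish on such coefficients. If some \<open>y\<close> has
  \<open>y\<^sup>z \<noteq> y\<^sup>w\<close>, the equation determines all \<open>f[x z;u w]\<close> by the one number \<open>f[y z;y w]\<close>, which then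
  cannot depend on \<open>y\<close>; these coefficients are those of the coboundary of \<open>g[z;w] = - f[y z;y w]\<close>.
  Subtracting it leaves an entropic cochain (lemma \<open>invariant_cocycle_splits\<close>).

  Finally let \<open>b\<close> be entropic and the coboundary of \<open>k\<close>. Its coefficients \<open>b[x z;u w]\<close> vanish unless
  \<open>z = w\<close>, and then they are the differences \<open>k[x\<^sup>z;u\<^sup>z] - k[x;u]\<close> and do not change when \<open>z\<close> acts on \<open>x\<close> and
  \<open>u\<close>. The sum over \<open>|Inn(Q)|\<close> steps of the orbit telescopes to \<open>0\<close> because the order of the right
  translation divides \<open>|Inn(Q)|\<close>. So \<open>|Inn(Q)| b[x z;u z] = 0\<close>, and \<open>b\<close> is \<open>0\<close>
  (lemma \<open>entropic_coboundary_zero\<close>).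

  The rack may be infinite. A matrix of coefficients then belongs to a cochain only if its rows are
  finite, and each construction of a cochain has to respect this.
\<close>

section \<open>Linear maps of tensors\<close>

definition tensor_linear ::
    "(('q, 'a::{comm_ring,comm_monoid_mult}) tensor \<Rightarrow> ('q, 'a) tensor) \<Rightarrow> bool" where
  "tensor_linear F \<longleftrightarrow>
     (\<forall>u v. F (u + v) = F u + F v) \<and> (\<forall>a v. F (scale a v) = scale a (F v))"

lemma lookup_scale [simp]: "Poly_Mapping.lookup (scale a v) w = a * Poly_Mapping.lookup v w"
  by (simp add: scale_def Poly_Mapping.map.rep_eq when_def)

lemma lookup_basis:
  "Poly_Mapping.lookup (basis w :: ('q, 'a::{comm_ring,comm_monoid_mult}) tensor) w' = (1 when w = w')"
  by (simp add: basis_def lookup_single)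

lemma scale_zero_left [simp]: "scale 0 v = 0"
  and scale_zero_right [simp]: "scale a 0 = 0"
  and scale_one [simp]: "scale 1 v = v"
  and scale_add_right: "scale a (u + v) = scale a u + scale a v"
  and scale_add_left: "scale (a + b) v = scale a v + scale b v"
  and scale_scale: "scale a (scale b v) = scale (a * b) v"
  by (rule poly_mapping_eqI; simp add: lookup_add algebra_simps)+

lemma scale_sum_right: "scale a (sum \<phi> S) = (\<Sum>w\<in>S. scale a (\<phi> w))"
  by (induction S rule: infinite_finite_induct) (simp_all add: scale_add_right)

lemma lin_ext_superset:
  assumes "finite S" "Poly_Mapping.keys v \<subseteq> S"
  shows "lin_ext \<phi> v = (\<Sum>w\<in>S. scale (Poly_Mapping.lookup v w) (\<phi> w))"
  unfolding lin_ext_def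
  by (rule sum.mono_neutral_left) (use assms in \<open>auto simp: in_keys_iff\<close>)

lemma tensor_linear_lin_ext: "tensor_linear (lin_ext \<phi>)"
  unfolding tensor_linear_def
proof (intro conjI allI)
  fix u v :: "('a, 'b) tensor"
  let ?S = "Poly_Mapping.keys u \<union> Poly_Mapping.keys v"
  have "lin_ext \<phi> (u + v) = (\<Sum>w\<in>?S. scale (Poly_Mapping.lookup (u + v) w) (\<phi> w))"
    by (rule lin_ext_superset) (auto simp: Poly_Mapping.keys_add)
  also have "\<dots> = lin_ext \<phi> u + lin_ext \<phi> v"
    by (simp add: lin_ext_superset [of ?S] lookup_add scale_add_left sum.distrib)
  finally show "lin_ext \<phi> (u + v) = lin_ext \<phi> u + lin_ext \<phi> v" .
next
  fix a and v :: "('a, 'b) tensor"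
  have "lin_ext \<phi> (scale a v)
      = (\<Sum>w\<in>Poly_Mapping.keys v. scale (Poly_Mapping.lookup (scale a v) w) (\<phi> w))"
    by (rule lin_ext_superset) (auto simp: in_keys_iff)
  then show "lin_ext \<phi> (scale a v) = scale a (lin_ext \<phi> v)"
    by (simp add: lin_ext_def scale_sum_right scale_scale)
qed

lemma lin_ext_basis [simp]: "lin_ext \<phi> (basis w) = \<phi> w"
  by (subst lin_ext_superset [of "{w}"]) (auto simp: basis_def lookup_single)

lemma lookup_lin_ext:
  "Poly_Mapping.lookup (lin_ext \<phi> v) z
    = (\<Sum>w\<in>Poly_Mapping.keys v. Poly_Mapping.lookup v w * Poly_Mapping.lookup (\<phi> w) z)"
  by (simp add: lin_ext_def lookup_sum)

lemma lin_ext_basis_id: "lin_ext basis v = v"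
proof (rule poly_mapping_eqI)
  fix z
  have "Poly_Mapping.lookup (lin_ext basis v) z
      = (\<Sum>w\<in>Poly_Mapping.keys v. Poly_Mapping.lookup v w when w = z)"
    unfolding lookup_lin_ext lookup_basis by (rule sum.cong) (auto simp: when_def)
  also have "\<dots> = Poly_Mapping.lookup v z"
    by (simp add: when_def in_keys_iff)
  finally show "Poly_Mapping.lookup (lin_ext basis v) z = Poly_Mapping.lookup v z" .
qed

lemma tensor_linear_zero: "tensor_linear F \<Longrightarrow> F 0 = 0"
  unfolding tensor_linear_def by (metis scale_zero_left)

lemma tensor_linear_sum:
  assumes "tensor_linear F"
  shows "F (sum \<phi> S) = (\<Sum>w\<in>S. F (\<phi> w))"
  using assms tensor_linear_zero [OF assms]
  by (induction S rule: infinite_finite_induct) (simp_all add: tensor_linear_def)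

lemma tensor_linear_expansion:
  assumes "tensor_linear F"
  shows "F v = lin_ext (\<lambda>w. F (basis w)) v"
proof -
  have "F v = F (lin_ext basis v)"
    by (simp add: lin_ext_basis_id)
  also have "\<dots> = lin_ext (\<lambda>w. F (basis w)) v"
    using assms unfolding lin_ext_def tensor_linear_sum [OF assms]
    by (simp add: tensor_linear_def)
  finally show ?thesis .
qed

lemma tensor_linear_id: "tensor_linear id"
  by (simp add: tensor_linear_def)

lemma tensor_linear_comp: "tensor_linear F \<Longrightarrow> tensor_linear G \<Longrightarrow> tensor_linear (F \<circ> G)"
  by (simp add: tensor_linear_def)

section \<open>Submodules of tensors\<close>

lemma ring_ideal_UNIV: "ring_ideal UNIV"
  by (simp add: ring_ideal_def)

lemma keys_subset_iff: "Poly_Mapping.keys v \<subseteq> S \<longleftrightarrow> (\<forall>w. w \<notin> S \<longrightarrow> Poly_Mapping.lookup v w = 0)"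
  by (auto simp: in_keys_iff)

lemma tensors_iff:
  "v \<in> tensors I Q n \<longleftrightarrow> (\<forall>w. w \<notin> words Q n \<longrightarrow> Poly_Mapping.lookup v w
      = 0) \<and> (\<forall>w. Poly_Mapping.lookup v w \<in> I)"
  by (simp add: tensors_def keys_subset_iff)

lemma tensors_eqI:
  assumes "u \<in> tensors I Q n" "v \<in> tensors J Q n"
    and "\<And>w. w \<in> words Q n \<Longrightarrow> Poly_Mapping.lookup u w = Poly_Mapping.lookup v w"
  shows "u = v"
  by (rule poly_mapping_eqI) (use assms in \<open>metis tensors_iff\<close>)

lemma tensors_subset_UNIV: "v \<in> tensors I Q n \<Longrightarrow> v \<in> tensors UNIV Q n"
  by (simp add: tensors_iff)

lemma
  assumes "ring_ideal I"
  shows tensors_zero: "0 \<in> tensors I Q n"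
    and tensors_add: "u \<in> tensors I Q n \<Longrightarrow> v \<in> tensors I Q n \<Longrightarrow> u + v \<in> tensors I Q n"
    and tensors_scale: "v \<in> tensors I Q n \<Longrightarrow> scale a v \<in> tensors I Q n"
    and tensors_diff: "u \<in> tensors I Q n \<Longrightarrow> v \<in> tensors I Q n \<Longrightarrow> u - v \<in> tensors I Q n"
proof -
  show zero: "0 \<in> tensors I Q n"
    using assms by (simp add: tensors_iff ring_ideal_def)
  show add: "u + v \<in> tensors I Q n" if "u \<in> tensors I Q n" "v \<in> tensors I Q n" for u v
    using assms that by (simp add: tensors_iff ring_ideal_def lookup_add)
  show scale: "scale a v \<in> tensors I Q n" if "v \<in> tensors I Q n" for a v
    using assms that by (simp add: tensors_iff ring_ideal_def)
  show "u - v \<in> tensors I Q n" if "u \<in> tensors I Q n" "v \<in> tensors I Q n"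
  proof -
    have "u - v = u + scale (- 1) v"
      by (rule poly_mapping_eqI) (simp add: lookup_add lookup_minus)
    then show ?thesis
      using add [OF that(1) scale [OF that(2)]] by metis
  qed
qed

lemma tensors_sum:
  assumes "ring_ideal I" "\<And>w. w \<in> S \<Longrightarrow> \<phi> w \<in> tensors I Q n"
  shows "sum \<phi> S \<in> tensors I Q n"
  using assms(2)
  by (induction S rule: infinite_finite_induct) (simp_all add: assms(1) tensors_zero tensors_add)

lemma basis_in_tensors: "w \<in> words Q n \<Longrightarrow> basis w \<in> tensors UNIV Q n"
  by (auto simp: tensors_iff lookup_basis when_def)

lemma lin_ext_in_tensors:
  assumes "ring_ideal I" "v \<in> tensors UNIV Q n" "\<And>w. w \<in> words Q n \<Longrightarrow> \<phi> w \<in> tensors I R m"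
  shows "lin_ext \<phi> v \<in> tensors I R m"
  unfolding lin_ext_def
proof (rule tensors_sum)
  fix w
  assume "w \<in> Poly_Mapping.keys v"
  then have "w \<in> words Q n"
    using assms(2) by (auto simp: tensors_def)
  then show "scale (Poly_Mapping.lookup v w) (\<phi> w) \<in> tensors I R m"
    by (simp add: assms tensors_scale)
qed (rule assms)

lemma lin_ext_cong:
  assumes "v \<in> tensors UNIV Q n" "\<And>w. w \<in> words Q n \<Longrightarrow> \<phi> w = \<psi> w"
  shows "lin_ext \<phi> v = lin_ext \<psi> v"
  unfolding lin_ext_def by (rule sum.cong) (use assms in \<open>auto simp: tensors_def\<close>)

section \<open>Linear maps that permute words\<close>

lemma lookup_permuted:
  assumes "tensor_linear F" "\<And>w. w \<in> words Q n \<Longrightarrow> F (basis w) = basis (\<beta> w)"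
    and "bij_betw \<beta> (words Q n) (words Q n)"
    and "v \<in> tensors UNIV Q n" "y \<in> words Q n"
  shows "Poly_Mapping.lookup (F v) (\<beta> y) = Poly_Mapping.lookup v y"
proof -
  have "F v = lin_ext (\<lambda>w. basis (\<beta> w)) v"
    unfolding tensor_linear_expansion [OF assms(1), of v]
    by (rule lin_ext_cong) (use assms in auto)
  then have "Poly_Mapping.lookup (F v) (\<beta> y)
      = (\<Sum>w\<in>Poly_Mapping.keys v. Poly_Mapping.lookup v w * (1 when \<beta> w = \<beta> y))"
    by (simp add: lookup_lin_ext lookup_basis)
  also have "\<dots> = (\<Sum>w\<in>Poly_Mapping.keys v. Poly_Mapping.lookup v w when w = y)"
  proof (rule sum.cong)
    fix w
    assume "w \<in> Poly_Mapping.keys v"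
    then have "w \<in> words Q n"
      using assms(4) by (auto simp: tensors_def)
    then have "\<beta> w = \<beta> y \<longleftrightarrow> w = y"
      using assms(3,5) by (auto simp: bij_betw_def inj_on_def)
    then show "Poly_Mapping.lookup v w * (1 when \<beta> w = \<beta> y) = (Poly_Mapping.lookup v w when w = y)"
      by (simp add: when_def)
  qed simp
  also have "\<dots> = Poly_Mapping.lookup v y"
    by (simp add: when_def in_keys_iff)
  finally show ?thesis .
qed

lemma permuted_in_tensors:
  assumes "tensor_linear F" "\<And>w. w \<in> words Q n \<Longrightarrow> F (basis w) = basis (\<beta> w)"
    and "bij_betw \<beta> (words Q n) (words Q n)"
    and "v \<in> tensors UNIV Q n"
  shows "F v \<in> tensors UNIV Q n"
  unfolding tensor_linear_expansion [OF assms(1), of v]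
  by (rule lin_ext_in_tensors [OF ring_ideal_UNIV assms(4)])
    (use assms in \<open>auto simp: bij_betw_def intro!: basis_in_tensors\<close>)

lemma bij_betw_permuted:
  assumes "tensor_linear F" "\<And>w. w \<in> words Q n \<Longrightarrow> F (basis w) = basis (\<beta> w)"
    and "bij_betw \<beta> (words Q n) (words Q n)"
  shows "bij_betw F (tensors UNIV Q n) (tensors UNIV Q n)"
  unfolding bij_betw_def
proof
  note permuted = lookup_permuted [OF assms] permuted_in_tensors [OF assms]
  show "inj_on F (tensors UNIV Q n)"
  proof (rule inj_onI)
    fix u v
    assume uv: "u \<in> tensors UNIV Q n" "v \<in> tensors UNIV Q n" "F u = F v"
    show "u = v"
      by (rule tensors_eqI [OF uv(1,2)]) (metis uv permuted(1))
  qed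
  show "F ` tensors UNIV Q n = tensors UNIV Q n"
  proof
    show "F ` tensors UNIV Q n \<subseteq> tensors UNIV Q n"
      using permuted(2) by auto
    show "tensors UNIV Q n \<subseteq> F ` tensors UNIV Q n"
    proof
      fix t :: "('a, 'b) tensor"
      assume t: "t \<in> tensors UNIV Q n"
      define \<gamma> where "\<gamma> = the_inv_into (words Q n) \<beta>"
      have \<gamma>: "\<gamma> w \<in> words Q n" "\<beta> (\<gamma> w) = w" if "w \<in> words Q n" for w
        using that assms(3) unfolding \<gamma>_def bij_betw_def
        by (auto intro: the_inv_into_into f_the_inv_into_f)
      let ?v = "lin_ext (\<lambda>w. basis (\<gamma> w)) t"
      have "F ?v = lin_ext (\<lambda>w. F (basis (\<gamma> w))) t"
        using tensor_linear_expansion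
          [OF tensor_linear_comp [OF assms(1) tensor_linear_lin_ext [of "\<lambda>w. basis (\<gamma> w)"]], of t]
        by simp
      also have "\<dots> = lin_ext basis t"
        by (rule lin_ext_cong [OF t]) (simp add: assms(2) \<gamma>)
      finally have "F ?v = t"
        by (simp add: lin_ext_basis_id)
      moreover have "?v \<in> tensors UNIV Q n"
        by (rule lin_ext_in_tensors [OF ring_ideal_UNIV t]) (simp add: basis_in_tensors \<gamma>)
      ultimately show "t \<in> F ` tensors UNIV Q n"
        by (metis image_eqI)
    qed
  qed
qed

text \<open>
  The partial coboundaries are conjugates by braids, and this is how the conjugation is evaluated:
  applying the inverse of a permutation of words to a tensor means reading its coefficients at the
  permuted words.
\<close>

lemma the_inv_permuted:
  assumes "tensor_linear F" "\<And>w. w \<in> words Q n \<Longrightarrow> F (basis w) = basis (\<beta> w)"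
    and "bij_betw \<beta> (words Q n) (words Q n)"
    and "t \<in> tensors I Q n"
  shows "the_inv_into (tensors UNIV Q n) F t \<in> tensors I Q n"
    and "y \<in> words Q n \<Longrightarrow> Poly_Mapping.lookup (the_inv_into (tensors UNIV Q n) F t) y
        = Poly_Mapping.lookup t (\<beta> y)"
proof -
  let ?v = "the_inv_into (tensors UNIV Q n) F t"
  note bij = bij_betw_permuted [OF assms(1-3)]
  have t: "t \<in> tensors UNIV Q n"
    using assms(4) by (rule tensors_subset_UNIV)
  have v: "?v \<in> tensors UNIV Q n" "F ?v = t"
    using bij t by (auto simp: bij_betw_def f_the_inv_into_f intro: the_inv_into_into)
  show lookup: "Poly_Mapping.lookup ?v y = Poly_Mapping.lookup t (\<beta> y)" if "y \<in> words Q n" for y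
    using lookup_permuted [OF assms(1-3) v(1) that] v(2) by simp
  have "Poly_Mapping.lookup ?v w \<in> I" for w
    using v(1) assms(4) lookup [of w] by (metis tensors_iff)
  then show "?v \<in> tensors I Q n"
    using v(1) by (simp add: tensors_iff)
qed

section \<open>Tensor products\<close>

text \<open>
  The left factor is homogeneous, so there is only one place where \<open>z\<close> can be cut into a word of the
  left factor and a word of the right one.
\<close>

lemma lookup_tensor_prod:
  assumes "Poly_Mapping.keys u \<subseteq> {w. length w = k}"
  shows "Poly_Mapping.lookup (tensor_prod u v) z
      = Poly_Mapping.lookup u (take k z) * Poly_Mapping.lookup v (drop k z)"
proof -
  have "Poly_Mapping.lookup (tensor_prod u v) z =
      (\<Sum>x\<in>Poly_Mapping.keys u. Poly_Mapping.lookup u x *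
        (\<Sum>y\<in>Poly_Mapping.keys v. Poly_Mapping.lookup v y * (1 when x @ y = z)))"
    by (simp add: tensor_prod_def lookup_lin_ext lookup_basis)
  also have "\<dots>
      = (\<Sum>x\<in>Poly_Mapping.keys u. Poly_Mapping.lookup u x * Poly_Mapping.lookup v (drop k z) when x = take k z)"
  proof (rule sum.cong)
    fix x
    assume "x \<in> Poly_Mapping.keys u"
    then have "length x = k"
      using assms by auto
    then have eq: "x @ y = z \<longleftrightarrow> x = take k z \<and> y = drop k z" for y
      by (metis append_eq_conv_conj)
    have "(\<Sum>y\<in>Poly_Mapping.keys v. Poly_Mapping.lookup v y * (1 when x @ y = z))
        = (\<Sum>y\<in>Poly_Mapping.keys v. if y = drop k z then (Poly_Mapping.lookup v y when x = take k z) else 0)"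
      by (rule sum.cong) (auto simp: eq when_def)
    also have "\<dots> = (Poly_Mapping.lookup v (drop k z) when x = take k z)"
      by (simp add: in_keys_iff when_def)
    finally show "Poly_Mapping.lookup u x * (\<Sum>y\<in>Poly_Mapping.keys v. Poly_Mapping.lookup v y * (1 when x @ y
        = z))
        = (Poly_Mapping.lookup u x * Poly_Mapping.lookup v (drop k z) when x = take k z)"
      by (simp add: when_def)
  qed simp
  also have "\<dots> = Poly_Mapping.lookup u (take k z) * Poly_Mapping.lookup v (drop k z)"
    by (simp add: when_def in_keys_iff)
  finally show ?thesis .
qed

lemma tensor_prod_basis: "tensor_prod (basis x) (basis y) = basis (x @ y)"
  by (simp add: tensor_prod_def)

lemma tensor_prod_in_tensors:
  assumes "ring_ideal I" "u \<in> tensors J Q k" "v \<in> tensors K Q l"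
    and "\<And>a b. a \<in> J \<Longrightarrow> b \<in> K \<Longrightarrow> a * b \<in> I"
  shows "tensor_prod u v \<in> tensors I Q (k + l)"
proof -
  have "Poly_Mapping.keys u \<subseteq> {w. length w = k}"
    using assms(2) by (auto simp: tensors_def words_def)
  note lookup = lookup_tensor_prod [OF this]
  have "Poly_Mapping.lookup (tensor_prod u v) w = 0" if "w \<notin> words Q (k + l)" for w
  proof (rule ccontr)
    assume "Poly_Mapping.lookup (tensor_prod u v) w \<noteq> 0"
    then have "Poly_Mapping.lookup u (take k w) \<noteq> 0" "Poly_Mapping.lookup v (drop k w) \<noteq> 0"
      by (auto simp: lookup)
    then have *: "take k w \<in> words Q k" "drop k w \<in> words Q l"
      using assms(2,3) by (auto simp: tensors_iff)
    then have "take k w @ drop k w \<in> words Q (k + l)"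
      unfolding words_def mem_Collect_eq set_append length_append by simp
    then show False
      using that by simp
  qed
  then show ?thesis
    using assms by (simp add: tensors_iff lookup)
qed

lemma tensor_linear_tensor_map: "tensor_linear (tensor_map k f g)"
  unfolding tensor_map_def by (rule tensor_linear_lin_ext)

lemma tensor_map_basis:
  "tensor_map k f g (basis w) = tensor_prod (f (basis (take k w))) (g (basis (drop k w)))"
  by (simp add: tensor_map_def)

section \<open>The braiding moves letters through words\<close>

lemma tensor_linear_braiding_at: "tensor_linear (braiding_at op j)"
  unfolding braiding_at_def by (rule tensor_linear_tensor_map)

lemma braiding_at_basis:
  "braiding_at op (Suc (length p)) (basis (p @ a # b # q)) = basis (p @ b # op a b # q)"
  by (simp add: braiding_at_def tensor_map_basis braiding_def tensor_prod_basis)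

lemma foldr_comp_append: "foldr (\<circ>) (Fs @ Gs) id = foldr (\<circ>) Fs id \<circ> foldr (\<circ>) Gs id"
  by (induction Fs) (simp_all add: comp_assoc)

lemma tensor_linear_foldr_comp:
  "(\<And>F. F \<in> set Fs \<Longrightarrow> tensor_linear F) \<Longrightarrow> tensor_linear (foldr (\<circ>) Fs id)"
  by (induction Fs) (auto intro: tensor_linear_id tensor_linear_comp)

lemma tensor_linear_right_braid: "tensor_linear (right_braid op n i)"
  unfolding right_braid_def by (rule tensor_linear_foldr_comp) (auto intro: tensor_linear_braiding_at)

lemma tensor_linear_left_braid: "tensor_linear (left_braid op i)"
  unfolding left_braid_def by (rule tensor_linear_foldr_comp) (auto intro: tensor_linear_braiding_at)

text \<open>
  The first braiding applied moves \<open>a\<close> past the next letter \<open>b\<close>, which turns it into \<open>op a b\<close>; what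
  remains to be done is the same task with a shorter \<open>q\<close>.
\<close>

lemma right_braid_basis:
  "right_braid op (length p + length q) (length p)
      (basis (p @ a # q) :: ('q, 'a::{comm_ring,comm_monoid_mult}) tensor)
    = basis (p @ q @ [foldl op a q])"
proof (induction q arbitrary: p a)
  case Nil
  then show ?case
    by (simp add: right_braid_def)
next
  case (Cons b q)
  let ?n = "length p + length (b # q)"
  have "rev [Suc (length p)..<Suc ?n] = rev [Suc (Suc (length p))..<Suc ?n] @ [Suc (length p)]"
    by (subst upt_conv_Cons) simp_all
  then have "(right_braid op ?n (length p) :: ('q, 'a) tensor \<Rightarrow> ('q, 'a) tensor)
      = right_braid op ?n (Suc (length p)) \<circ> braiding_at op (Suc (length p))"
    unfolding right_braid_def by (simp add: foldr_comp_append del: upt_Suc foldr_append)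
  then show ?case
    using Cons.IH [of "p @ [b]" "op a b"] by (simp add: braiding_at_basis)
qed

text \<open>
  Here the moving letter \<open>a\<close> stays as it is, and it acts on every letter that it passes.
\<close>

lemma left_braid_basis:
  "left_braid op (length p) (basis (p @ a # q) :: ('q, 'a::{comm_ring,comm_monoid_mult}) tensor)
    = basis (a # map (\<lambda>x. op x a) p @ q)"
proof (induction p arbitrary: q rule: rev_induct)
  case Nil
  then show ?case
    by (simp add: left_braid_def)
next
  case (snoc b p)
  have "[1..<Suc (Suc (length p))] = [1..<Suc (length p)] @ [Suc (length p)]"
    by simp
  then have "(left_braid op (Suc (length p)) :: ('q, 'a) tensor \<Rightarrow> ('q, 'a) tensor)
      = left_braid op (length p) \<circ> braiding_at op (Suc (length p))"
    unfolding left_braid_def by (simp add: foldr_comp_append del: upt_Suc foldr_append)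
  then show ?case
    using snoc.IH [of "op b a # q"] by (simp add: braiding_at_basis)
qed

text \<open>
  The effect of the two braids on words of any shape. The form by positions is a function
  of the word, as inverting the braids requires; computations use the split forms below.
\<close>

definition right_word :: "('q \<Rightarrow> 'q \<Rightarrow> 'q) \<Rightarrow> nat \<Rightarrow> 'q list \<Rightarrow> 'q list" where
  "right_word op i w = take i w @ drop (Suc i) w @ [foldl op (w ! i) (drop (Suc i) w)]"

definition left_word :: "('q \<Rightarrow> 'q \<Rightarrow> 'q) \<Rightarrow> nat \<Rightarrow> 'q list \<Rightarrow> 'q list" where
  "left_word op i w = w ! i # map (\<lambda>x. op x (w ! i)) (take i w) @ drop (Suc i) w"

lemma right_word_split: "right_word op (length p) (p @ a # q) = p @ q @ [foldl op a q]"
  by (simp add: right_word_def)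

lemma left_word_split: "left_word op (length p) (p @ a # q) = a # map (\<lambda>x. op x a) p @ q"
  by (simp add: left_word_def)

lemma words_splitE:
  assumes "w \<in> words Q (Suc n)" "i \<le> n"
  obtains p a q where "w = p @ a # q" "length p = i" "length q = n - i"
    "set p \<subseteq> Q" "a \<in> Q" "set q \<subseteq> Q"
proof
  have i: "i < length w"
    using assms by (simp add: words_def)
  then show split: "w = take i w @ w ! i # drop (Suc i) w"
    by (rule id_take_nth_drop)
  have "set w \<subseteq> Q"
    using assms(1) by (simp add: words_def)
  then show "set (take i w) \<subseteq> Q" "w ! i \<in> Q" "set (drop (Suc i) w) \<subseteq> Q"
    using i by (auto dest: in_set_takeD in_set_dropD)
qed (use assms in \<open>auto simp: words_def\<close>)

section \<open>Matrix coefficients of cochains\<close>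

definition coef :: "('q, 'a::{comm_ring,comm_monoid_mult}) cochain \<Rightarrow> 'q list \<Rightarrow> 'q list \<Rightarrow> 'a" where
  "coef f x y = Poly_Mapping.lookup (f (basis x)) y"

lemma coef_finite: "finite {y. coef f x y \<noteq> 0}"
  by (simp add: coef_def)

lemma finite_coef_row: "inj_on \<phi> U \<Longrightarrow> finite {u \<in> U. coef f x (\<phi> u) \<noteq> 0}"
  by (rule inj_on_finite [of \<phi> _ "{y. coef f x y \<noteq> 0}"])
    (auto simp: coef_finite intro: inj_on_subset)

lemma coef_zero [simp]: "coef 0 x y = 0"
  and coef_add [simp]: "coef (f + g) x y = coef f x y + coef g x y"
  and coef_diff [simp]: "coef (f - g) x y = coef f x y - coef g x y"
  and coef_scale [simp]: "coef (cochain_scale a f) x y = a * coef f x y"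
  by (simp_all add: coef_def cochain_scale_def lookup_add lookup_minus)

lemma coef_sum [simp]: "coef (sum F S) x y = (\<Sum>s\<in>S. coef (F s) x y)"
  by (induction S rule: infinite_finite_induct)
    (simp_all only: sum.infinite sum.empty sum.insert coef_zero coef_add not_False_eq_True)

lemma cochain_scale_zero [simp]: "cochain_scale a 0 = 0" "cochain_scale 0 f = 0"
  by (simp_all add: cochain_scale_def fun_eq_iff)

lemma cochain_scale_add: "cochain_scale a (f + g) = cochain_scale a f + cochain_scale a g"
  by (simp add: cochain_scale_def fun_eq_iff scale_add_right)

lemma cochain_scale_sum: "cochain_scale a (sum F S) = (\<Sum>s\<in>S. cochain_scale a (F s))"
  by (induction S rule: infinite_finite_induct)
    (simp_all only: sum.infinite sum.empty sum.insert cochain_scale_zero cochain_scale_add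
      not_False_eq_True)

lemma cochain_scale_commute: "cochain_scale a (cochain_scale b f) = cochain_scale b (cochain_scale a f)"
  by (simp add: cochain_scale_def scale_scale mult.commute)

lemma cochain_submodule_diff:
  assumes "cochain_submodule S M" "f \<in> S" "g \<in> S"
  shows "f - g \<in> S"
proof -
  have "f - g = f + cochain_scale (- 1) g"
    by (intro ext poly_mapping_eqI) (simp add: cochain_scale_def lookup_add lookup_minus)
  then show ?thesis
    using assms unfolding cochain_submodule_def by metis
qed

lemma direct_sum_unique_component:
  assumes sum: "cochain_direct_sum M S T" and "f \<in> M"
  shows "\<exists>!e. e \<in> S \<and> f - e \<in> T"
proof (rule ex_ex1I)
  obtain e t where "e \<in> S" "t \<in> T" "f = e + t"
    using assms unfolding cochain_direct_sum_def by blast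
  then show "\<exists>e. e \<in> S \<and> f - e \<in> T"
    by (metis add_diff_cancel_left')
next
  fix e e'
  assume e: "e \<in> S \<and> f - e \<in> T" "e' \<in> S \<and> f - e' \<in> T"
  have sub: "cochain_submodule S M" "cochain_submodule T M"
    using sum by (auto simp: cochain_direct_sum_def)
  have "e - e' \<in> S"
    using e cochain_submodule_diff [OF sub(1)] by blast
  moreover have "(f - e') - (f - e) \<in> T"
    using e cochain_submodule_diff [OF sub(2)] by blast
  ultimately have "e - e' \<in> S \<inter> T"
    by simp
  then have "e - e' = 0"
    using sum unfolding cochain_direct_sum_def by blast
  then show "e = e'"
    by (simp only: right_minus_eq)
qed

text \<open>
  The image of a natural number in a ring that may be zero is written as a sum of ones; this makes
  it agree with the sum of ones that averaging over a group produces.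
\<close>

lemma sum_one_card:
  assumes "finite S"
  shows "(\<Sum>s\<in>S. 1) = (\<Sum>i<card S. 1 :: 'a::{comm_ring,comm_monoid_mult})"
proof -
  obtain h where "bij_betw h {0..<card S} S"
    using ex_bij_betw_nat_finite [OF assms] by blast
  from sum.reindex_bij_betw [OF this, of "\<lambda>_. 1 :: 'a"] show ?thesis
    by (simp only: atLeast0LessThan)
qed

section \<open>Racks and their action on words\<close>

locale rack_with_ideal =
  fixes \<mm> :: "'a::{comm_ring,comm_monoid_mult} set"
    and Q :: "'q set"
    and op :: "'q \<Rightarrow> 'q \<Rightarrow> 'q" (infixl \<open>\<rhd>\<close> 70)
  assumes ideal: "ring_ideal \<mm>"
    and rack: "rack Q op"
begin

lemma op_bij: "y \<in> Q \<Longrightarrow> bij_betw (\<lambda>x. x \<rhd> y) Q Q"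
  and op_dist: "x \<in> Q \<Longrightarrow> y \<in> Q \<Longrightarrow> z \<in> Q \<Longrightarrow> x \<rhd> y \<rhd> z = (x \<rhd> z) \<rhd> (y \<rhd> z)"
  using rack by (simp_all only: rack_def)

lemma op_closed [simp]: "x \<in> Q \<Longrightarrow> y \<in> Q \<Longrightarrow> x \<rhd> y \<in> Q"
  using op_bij by (rule bij_betw_apply)

lemma op_cancel [simp]: "x \<in> Q \<Longrightarrow> x' \<in> Q \<Longrightarrow> y \<in> Q \<Longrightarrow> x \<rhd> y = x' \<rhd> y \<longleftrightarrow> x = x'"
  using inj_on_eq_iff [OF bij_betw_imp_inj_on [OF op_bij]] by metis

lemma op_surj: "x \<in> Q \<Longrightarrow> y \<in> Q \<Longrightarrow> \<exists>x'\<in>Q. x' \<rhd> y = x"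
  using bij_betw_imp_surj_on [OF op_bij] by (metis imageE)

lemma foldl_closed [simp]: "a \<in> Q \<Longrightarrow> set q \<subseteq> Q \<Longrightarrow> foldl op a q \<in> Q"
  by (induction q arbitrary: a) auto

lemma foldl_cancel:
  "a \<in> Q \<Longrightarrow> a' \<in> Q \<Longrightarrow> set q \<subseteq> Q \<Longrightarrow> foldl op a q = foldl op a' q \<longleftrightarrow> a = a'"
  by (induction q arbitrary: a a') auto

lemma foldl_surj: "set q \<subseteq> Q \<Longrightarrow> b \<in> Q \<Longrightarrow> \<exists>a\<in>Q. foldl op a q = b"
proof (induction q arbitrary: b rule: rev_induct)
  case (snoc c q)
  then obtain b' where "b' \<in> Q" "b' \<rhd> c = b"
    using op_surj [of b c] by auto
  with snoc show ?case
    by fastforce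
qed simp

lemma map_op_cancel:
  assumes "a \<in> Q" "set p \<subseteq> Q" "set p' \<subseteq> Q"
  shows "map (\<lambda>x. x \<rhd> a) p = map (\<lambda>x. x \<rhd> a) p' \<longleftrightarrow> p = p'"
  by (rule inj_on_map_eq_map) (use assms in \<open>auto simp: inj_on_def subset_iff\<close>)

lemma map_op_surj: "a \<in> Q \<Longrightarrow> set p \<subseteq> Q \<Longrightarrow> \<exists>p'. set p' \<subseteq> Q \<and> map (\<lambda>x. x \<rhd> a) p' = p"
proof (induction p)
  case (Cons b p)
  then obtain b' p' where "b' \<in> Q" "b' \<rhd> a = b" "set p' \<subseteq> Q" "map (\<lambda>x. x \<rhd> a) p' = p"
    using op_surj [of b a] by auto
  then show ?case
    by (intro exI [of _ "b' # p'"]) auto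
qed simp

text \<open>
  All but the last letter of the image are letters of the given word. The last one determines the
  letter that was moved, because the word \<open>q\<close> acts on \<open>Q\<close> bijectively.
\<close>

lemma bij_right_word:
  assumes "i \<le> n"
  shows "bij_betw (right_word op i) (words Q (Suc n)) (words Q (Suc n))"
  unfolding bij_betw_def
proof
  show "inj_on (right_word op i) (words Q (Suc n))"
  proof (rule inj_onI)
    fix w w'
    assume w: "w \<in> words Q (Suc n)" "w' \<in> words Q (Suc n)" "right_word op i w = right_word op i w'"
    obtain p a q where
      "w = p @ a # q" "length p = i" "length q = n - i" "set p \<subseteq> Q" "a \<in> Q" "set q \<subseteq> Q"
      by (rule words_splitE [OF w(1) assms])
    moreover obtain p' a' q' where
      "w' = p' @ a' # q'" "length p' = i" "length q' = n - i" "set p' \<subseteq> Q" "a' \<in> Q" "set q' \<subseteq> Q"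
      by (rule words_splitE [OF w(2) assms])
    ultimately show "w = w'"
      using w(3) right_word_split [of op p a q] right_word_split [of op p' a' q']
      by (auto simp: foldl_cancel)
  qed
  show "right_word op i ` words Q (Suc n) = words Q (Suc n)"
  proof (intro equalityI subsetI)
    fix w
    assume "w \<in> right_word op i ` words Q (Suc n)"
    then obtain w' where w': "w' \<in> words Q (Suc n)" "w = right_word op i w'"
      by blast
    then show "w \<in> words Q (Suc n)"
      by (rule_tac words_splitE [OF w'(1) assms])
        (use assms in \<open>auto simp: right_word_split words_def\<close>)
  next
    fix w
    assume w: "w \<in> words Q (Suc n)"
    then obtain r b where rb: "w = r @ [b]" "length r = n" "set r \<subseteq> Q" "b \<in> Q"
      by (rule words_splitE [where i = n]) auto
    define p q where "p = take i r" and "q = drop i r"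
    have pq: "r = p @ q" "length p = i" "length q = n - i" "set p \<subseteq> Q" "set q \<subseteq> Q"
      using rb assms by (auto simp: p_def q_def dest: in_set_takeD in_set_dropD)
    obtain a where a: "a \<in> Q" "foldl op a q = b"
      using foldl_surj pq rb by blast
    have "right_word op i (p @ a # q) = w"
      using right_word_split [of op p a q] pq rb a by simp
    moreover have "p @ a # q \<in> words Q (Suc n)"
      using pq a assms by (simp add: words_def)
    ultimately show "w \<in> right_word op i ` words Q (Suc n)"
      by blast
  qed
qed

text \<open>
  The moved letter is the first letter of the image, and its bijective action can be undone on the
  letters that it has passed.
\<close>

lemma bij_left_word:
  assumes "i \<le> n"
  shows "bij_betw (left_word op i) (words Q (Suc n)) (words Q (Suc n))"
  unfolding bij_betw_def
proof
  show "inj_on (left_word op i) (words Q (Suc n))"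
  proof (rule inj_onI)
    fix w w'
    assume w: "w \<in> words Q (Suc n)" "w' \<in> words Q (Suc n)" "left_word op i w = left_word op i w'"
    obtain p a q where
      "w = p @ a # q" "length p = i" "length q = n - i" "set p \<subseteq> Q" "a \<in> Q" "set q \<subseteq> Q"
      by (rule words_splitE [OF w(1) assms])
    moreover obtain p' a' q' where
      "w' = p' @ a' # q'" "length p' = i" "length q' = n - i" "set p' \<subseteq> Q" "a' \<in> Q" "set q' \<subseteq> Q"
      by (rule words_splitE [OF w(2) assms])
    ultimately show "w = w'"
      using w(3) left_word_split [of op p a q] left_word_split [of op p' a' q']
      by (auto simp: map_op_cancel)
  qed
  show "left_word op i ` words Q (Suc n) = words Q (Suc n)"
  proof (intro equalityI subsetI)
    fix w
    assume "w \<in> left_word op i ` words Q (Suc n)"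
    then obtain w' where w': "w' \<in> words Q (Suc n)" "w = left_word op i w'"
      by blast
    then show "w \<in> words Q (Suc n)"
      by (rule_tac words_splitE [OF w'(1) assms])
        (use assms in \<open>auto simp: left_word_split words_def subset_iff\<close>)
  next
    fix w
    assume w: "w \<in> words Q (Suc n)"
    then obtain r a where ra: "w = a # r" "length r = n" "set r \<subseteq> Q" "a \<in> Q"
      by (rule words_splitE [where i = 0]) auto
    define p q where "p = take i r" and "q = drop i r"
    have pq: "r = p @ q" "length p = i" "length q = n - i" "set p \<subseteq> Q" "set q \<subseteq> Q"
      using ra assms by (auto simp: p_def q_def dest: in_set_takeD in_set_dropD)
    obtain p' where p': "set p' \<subseteq> Q" "map (\<lambda>x. x \<rhd> a) p' = p"
      using map_op_surj pq ra by blast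
    then have len: "length p' = i"
      using pq(2) by auto
    have "left_word op i (p' @ a # q) = w"
      using left_word_split [of op p' a q] pq ra p' len by simp
    moreover have "p' @ a # q \<in> words Q (Suc n)"
      using pq p' ra assms len by (simp add: words_def)
    ultimately show "w \<in> left_word op i ` words Q (Suc n)"
      by blast
  qed
qed

lemma right_braid_word:
  assumes "i \<le> n" "w \<in> words Q (Suc n)"
  shows "right_braid op n i (basis w :: ('q, 'a) tensor) = basis (right_word op i w)"
proof (rule words_splitE [OF assms(2,1)])
  fix p a q
  assume "w = p @ a # q" "length p = i" "length q = n - i"
  then show ?thesis
    using right_braid_basis [of op p q a, where 'a = 'a] right_word_split [of op p a q] assms(1)
    by simp
qed

lemma left_braid_word:
  assumes "i \<le> n" "w \<in> words Q (Suc n)"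
  shows "left_braid op i (basis w :: ('q, 'a) tensor) = basis (left_word op i w)"
  by (rule words_splitE [OF assms(2,1)])
    (use assms(1) in \<open>auto simp: left_braid_basis left_word_split\<close>)

lemmas right_permuted =
  tensor_linear_right_braid right_braid_word bij_right_word
lemmas left_permuted =
  tensor_linear_left_braid left_braid_word bij_left_word

section \<open>Partial coboundaries of cochains\<close>

lemma cochainD:
  assumes "f \<in> cochains \<mm> Q n"
  shows "v \<notin> tensors UNIV Q n \<Longrightarrow> f v = 0"
    and "v \<in> tensors UNIV Q n \<Longrightarrow> f v \<in> tensors \<mm> Q n"
    and "u \<in> tensors UNIV Q n \<Longrightarrow> v \<in> tensors UNIV Q n \<Longrightarrow> f (u + v) = f u + f v"
    and "v \<in> tensors UNIV Q n \<Longrightarrow> f (scale a v) = scale a (f v)"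
  using assms by (auto simp: cochains_def)

lemma ideal_mult: "a \<in> \<mm> \<Longrightarrow> b * a \<in> \<mm>" "a \<in> \<mm> \<Longrightarrow> a * b \<in> \<mm>"
  using ideal by (auto simp: ring_ideal_def mult.commute [of a])

lemma right_insert_in_tensors:
  assumes "f \<in> cochains \<mm> Q n" "v \<in> tensors UNIV Q (Suc n)"
  shows "tensor_map n f id v \<in> tensors \<mm> Q (Suc n)"
  unfolding tensor_map_def
proof (rule lin_ext_in_tensors [OF ideal assms(2)])
  fix w
  assume w: "w \<in> words Q (Suc n)"
  have "tensor_prod (f (basis (take n w))) (id (basis (drop n w))) \<in> tensors \<mm> Q (n + 1)"
  proof (rule tensor_prod_in_tensors [OF ideal])
    show "f (basis (take n w)) \<in> tensors \<mm> Q n"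
      using w by (intro cochainD [OF assms(1)] basis_in_tensors)
        (auto simp: words_def dest: in_set_takeD)
    show "id (basis (drop n w)) \<in> tensors UNIV Q 1"
      using w set_drop_subset [of n w] by (auto simp: words_def intro!: basis_in_tensors)
  qed (simp add: ideal_mult)
  then show "tensor_prod (f (basis (take n w))) (id (basis (drop n w))) \<in> tensors \<mm> Q (Suc n)"
    by simp
qed

lemma left_insert_in_tensors:
  assumes "f \<in> cochains \<mm> Q n" "v \<in> tensors UNIV Q (Suc n)"
  shows "tensor_map 1 id f v \<in> tensors \<mm> Q (Suc n)"
  unfolding tensor_map_def
proof (rule lin_ext_in_tensors [OF ideal assms(2)])
  fix w
  assume w: "w \<in> words Q (Suc n)"
  have "tensor_prod (id (basis (take 1 w))) (f (basis (drop 1 w))) \<in> tensors \<mm> Q (1 + n)"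
  proof (rule tensor_prod_in_tensors [OF ideal])
    show "f (basis (drop 1 w)) \<in> tensors \<mm> Q n"
      using w by (intro cochainD [OF assms(1)] basis_in_tensors)
        (auto simp: words_def dest: in_set_dropD)
    show "id (basis (take 1 w)) \<in> tensors UNIV Q 1"
      using w set_take_subset [of 1 w] by (auto simp: words_def intro!: basis_in_tensors)
  qed (simp add: ideal_mult)
  then show "tensor_prod (id (basis (take 1 w))) (f (basis (drop 1 w))) \<in> tensors \<mm> Q (Suc n)"
    by simp
qed

lemma partial_coboundary_in_tensors:
  assumes "f \<in> cochains \<mm> Q n" "i \<le> n" "v \<in> tensors UNIV Q (Suc n)"
  shows "partial_coboundary Q op n i f v \<in> tensors \<mm> Q (Suc n)"
proof -
  have "right_braid op n i v \<in> tensors UNIV Q (Suc n)"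
    by (rule permuted_in_tensors [OF right_permuted]) (use assms in auto)
  then have 1: "the_inv_into (tensors UNIV Q (Suc n)) (right_braid op n i)
      (tensor_map n f id (right_braid op n i v)) \<in> tensors \<mm> Q (Suc n)"
    by (intro the_inv_permuted(1) [OF right_permuted, where I = \<mm>] right_insert_in_tensors assms(1))
      (use assms in auto)
  have "left_braid op i v \<in> tensors UNIV Q (Suc n)"
    by (rule permuted_in_tensors [OF left_permuted]) (use assms in auto)
  then have 2: "the_inv_into (tensors UNIV Q (Suc n)) (left_braid op i)
      (tensor_map 1 id f (left_braid op i v)) \<in> tensors \<mm> Q (Suc n)"
    by (intro the_inv_permuted(1) [OF left_permuted, where I = \<mm>] left_insert_in_tensors assms(1))
      (use assms in auto)
  show ?thesis
    using tensors_diff [OF ideal 1 2] assms(3) by (simp add: partial_coboundary_def)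
qed

lemma lookup_partial_coboundary:
  assumes "f \<in> cochains \<mm> Q n" "i \<le> n" "v \<in> tensors UNIV Q (Suc n)" "y \<in> words Q (Suc n)"
  shows "Poly_Mapping.lookup (partial_coboundary Q op n i f v) y =
    Poly_Mapping.lookup (tensor_map n f id (right_braid op n i v)) (right_word op i y)
    - Poly_Mapping.lookup (tensor_map 1 id f (left_braid op i v)) (left_word op i y)"
proof -
  have "right_braid op n i v \<in> tensors UNIV Q (Suc n)"
    by (rule permuted_in_tensors [OF right_permuted]) (use assms in auto)
  then have 1: "Poly_Mapping.lookup (the_inv_into (tensors UNIV Q (Suc n)) (right_braid op n i)
      (tensor_map n f id (right_braid op n i v))) y
      = Poly_Mapping.lookup (tensor_map n f id (right_braid op n i v)) (right_word op i y)"
    by (intro the_inv_permuted(2) [OF right_permuted, where I = \<mm>] right_insert_in_tensors assms(1))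
      (use assms in auto)
  have "left_braid op i v \<in> tensors UNIV Q (Suc n)"
    by (rule permuted_in_tensors [OF left_permuted]) (use assms in auto)
  then have 2: "Poly_Mapping.lookup (the_inv_into (tensors UNIV Q (Suc n)) (left_braid op i)
      (tensor_map 1 id f (left_braid op i v))) y
      = Poly_Mapping.lookup (tensor_map 1 id f (left_braid op i v)) (left_word op i y)"
    by (intro the_inv_permuted(2) [OF left_permuted, where I = \<mm>] left_insert_in_tensors assms(1))
      (use assms in auto)
  show ?thesis
    using assms(3) by (simp only: partial_coboundary_def if_True lookup_minus 1 2)
qed

lemma partial_coboundary_in_cochains:
  assumes "f \<in> cochains \<mm> Q n" "i \<le> n"
  shows "partial_coboundary Q op n i f \<in> cochains \<mm> Q (Suc n)"
proof -
  note in_tensors = partial_coboundary_in_tensors [OF assms]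
  note lookup = lookup_partial_coboundary [OF assms]
  have *: "tensor_linear (tensor_map n f id \<circ> right_braid op n i)"
    "tensor_linear (tensor_map 1 id f \<circ> left_braid op i)"
    by (intro tensor_linear_comp tensor_linear_tensor_map tensor_linear_right_braid
        tensor_linear_left_braid)+
  have "partial_coboundary Q op n i f (u + v)
      = partial_coboundary Q op n i f u + partial_coboundary Q op n i f v"
    if uv: "u \<in> tensors UNIV Q (Suc n)" "v \<in> tensors UNIV Q (Suc n)" for u v
  proof (rule tensors_eqI)
    have sum: "u + v \<in> tensors UNIV Q (Suc n)"
      by (intro tensors_add ring_ideal_UNIV uv)
    then show "partial_coboundary Q op n i f (u + v) \<in> tensors \<mm> Q (Suc n)"
      by (rule in_tensors)
    show "partial_coboundary Q op n i f u + partial_coboundary Q op n i f v \<in> tensors \<mm> Q (Suc n)"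
      by (intro tensors_add ideal in_tensors uv)
    fix y
    assume "y \<in> words Q (Suc n)"
    then show "Poly_Mapping.lookup (partial_coboundary Q op n i f (u + v)) y
      = Poly_Mapping.lookup (partial_coboundary Q op n i f u + partial_coboundary Q op n i f v) y"
      using * by (simp add: lookup uv sum lookup_add tensor_linear_def)
  qed
  moreover have "partial_coboundary Q op n i f (scale a v) = scale a (partial_coboundary Q op n i f v)"
    if v: "v \<in> tensors UNIV Q (Suc n)" for a v
  proof (rule tensors_eqI)
    have scaled: "scale a v \<in> tensors UNIV Q (Suc n)"
      by (intro tensors_scale ring_ideal_UNIV v)
    then show "partial_coboundary Q op n i f (scale a v) \<in> tensors \<mm> Q (Suc n)"
      by (rule in_tensors)
    show "scale a (partial_coboundary Q op n i f v) \<in> tensors \<mm> Q (Suc n)"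
      by (intro tensors_scale ideal in_tensors v)
    fix y
    assume "y \<in> words Q (Suc n)"
    then show "Poly_Mapping.lookup (partial_coboundary Q op n i f (scale a v)) y
      = Poly_Mapping.lookup (scale a (partial_coboundary Q op n i f v)) y"
      using * by (simp add: lookup v scaled tensor_linear_def algebra_simps)
  qed
  ultimately show ?thesis
    using in_tensors by (simp add: cochains_def partial_coboundary_def)
qed

section \<open>Cochains and their coefficients\<close>

lemma cochain_expansion:
  assumes "f \<in> cochains \<mm> Q n" "v \<in> tensors UNIV Q n"
  shows "f v = lin_ext (\<lambda>w. f (basis w)) v"
proof -
  have f0: "f 0 = 0"
    using cochainD(4) [OF assms(1), of 0 0] by (simp add: tensors_zero ring_ideal_UNIV)
  have "f (\<Sum>w\<in>S. scale (Poly_Mapping.lookup v w) (basis w))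
      = (\<Sum>w\<in>S. scale (Poly_Mapping.lookup v w) (f (basis w)))"
    if "finite S" "S \<subseteq> words Q n" for S
    using that
  proof (induction S rule: finite_induct)
    case (insert w S)
    have "scale (Poly_Mapping.lookup v w) (basis w) \<in> tensors UNIV Q n"
      "(\<Sum>w\<in>S. scale (Poly_Mapping.lookup v w) (basis w)) \<in> tensors UNIV Q n"
      using insert.prems
      by (auto intro!: tensors_sum tensors_scale ring_ideal_UNIV basis_in_tensors)
    with insert show ?case
      by (simp add: cochainD [OF assms(1)] basis_in_tensors)
  qed (simp add: f0)
  then have "f (lin_ext basis v) = lin_ext (\<lambda>w. f (basis w)) v"
    using assms(2) by (auto simp: lin_ext_def tensors_def)
  then show ?thesis
    by (simp add: lin_ext_basis_id)
qed

lemma cochain_eqI: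
  assumes "f \<in> cochains \<mm> Q n" "g \<in> cochains \<mm> Q n"
    and "\<And>x y. x \<in> words Q n \<Longrightarrow> y \<in> words Q n \<Longrightarrow> coef f x y = coef g x y"
  shows "f = g"
proof
  fix v
  show "f v = g v"
  proof (cases "v \<in> tensors UNIV Q n")
    case True
    have "f (basis w) = g (basis w)" if "w \<in> words Q n" for w
      by (rule tensors_eqI [of _ \<mm> Q n _ \<mm>])
        (use assms that in \<open>auto simp: coef_def intro: cochainD basis_in_tensors\<close>)
    then show ?thesis
      unfolding cochain_expansion [OF assms(1) True] cochain_expansion [OF assms(2) True]
      by (intro lin_ext_cong [OF True])
  qed (use assms cochainD in metis)
qed

text \<open>
  A matrix defines a cochain exactly under these conditions. Only the rows have to be finite; a
  column may have infinitely many entries when \<open>Q\<close> is infinite.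
\<close>

lemma cochain_with_coefs:
  assumes "\<And>x. x \<in> words Q n \<Longrightarrow> finite {y. c x y \<noteq> 0}"
    and "\<And>x y. x \<in> words Q n \<Longrightarrow> c x y \<in> \<mm>"
    and "\<And>x y. x \<in> words Q n \<Longrightarrow> y \<notin> words Q n \<Longrightarrow> c x y = 0"
  obtains f where "f \<in> cochains \<mm> Q n" "\<And>x y. x \<in> words Q n \<Longrightarrow> coef f x y = c x y"
proof
  let ?\<phi> = "\<lambda>x. Abs_poly_mapping (c x)"
  let ?f = "\<lambda>v. if v \<in> tensors UNIV Q n then lin_ext ?\<phi> v else 0"
  have lookup: "Poly_Mapping.lookup (?\<phi> x) = c x" if "x \<in> words Q n" for x
    using assms(1) [OF that] by (simp add: Abs_poly_mapping_inverse)
  then have "?\<phi> x \<in> tensors \<mm> Q n" if "x \<in> words Q n" for x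
    using assms that by (simp add: tensors_iff)
  then show "?f \<in> cochains \<mm> Q n"
    using tensor_linear_lin_ext [of ?\<phi>]
    by (auto simp: cochains_def tensor_linear_def tensors_add tensors_scale ring_ideal_UNIV
        intro!: lin_ext_in_tensors ideal)
  show "coef ?f x y = c x y" if "x \<in> words Q n" for x y
    using that by (simp add: coef_def basis_in_tensors lookup)
qed

lemma coef_in_ideal:
  assumes "f \<in> cochains \<mm> Q n" "x \<in> words Q n"
  shows "coef f x y \<in> \<mm>"
  using cochainD(2) [OF assms(1) basis_in_tensors [OF assms(2)]]
  by (auto simp: coef_def tensors_iff)

lemma cochains_zero: "0 \<in> cochains \<mm> Q n"
  by (simp add: cochains_def tensors_zero ideal)

lemma cochains_add: "f \<in> cochains \<mm> Q n \<Longrightarrow> g \<in> cochains \<mm> Q n \<Longrightarrow> f + g \<in> cochains \<mm> Q n"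
  by (simp add: cochains_def tensors_add ideal scale_add_right algebra_simps)

lemma cochains_scale: "f \<in> cochains \<mm> Q n \<Longrightarrow> cochain_scale a f \<in> cochains \<mm> Q n"
  by (simp add: cochains_def cochain_scale_def tensors_scale ideal scale_add_right scale_scale
      mult.commute)

lemma cochains_diff:
  assumes "f \<in> cochains \<mm> Q n" "g \<in> cochains \<mm> Q n"
  shows "f - g \<in> cochains \<mm> Q n"
proof -
  have "f - g = f + cochain_scale (- 1) g"
    by (intro ext poly_mapping_eqI) (simp add: cochain_scale_def lookup_add lookup_minus)
  then show ?thesis
    using cochains_add [OF assms(1) cochains_scale [OF assms(2)]] by metis
qed

lemma cochains_sum:
  "(\<And>s. s \<in> S \<Longrightarrow> F s \<in> cochains \<mm> Q n) \<Longrightarrow> sum F S \<in> cochains \<mm> Q n"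
  by (induction S rule: infinite_finite_induct) (simp_all add: cochains_zero cochains_add)

text \<open>
  Each of the two summands is a tensor product of \<open>f\<close> with the identity on one letter, taken between
  relabelled words. The identity contributes the condition that the letters moved to the end agree.
\<close>

lemma coef_partial_coboundary:
  assumes f: "f \<in> cochains \<mm> Q (length p + length q)"
    and "set p \<subseteq> Q" "a \<in> Q" "set q \<subseteq> Q" "set p' \<subseteq> Q" "a' \<in> Q" "set q' \<subseteq> Q"
    and len: "length p' = length p" "length q' = length q"
  shows "coef (partial_coboundary Q op (length p + length q) (length p) f) (p @ a # q) (p' @ a' # q')
    = (coef f (p @ q) (p' @ q') when foldl op a q = foldl op a' q')
      - (coef f (map (\<lambda>x. x \<rhd> a) p @ q) (map (\<lambda>x. x \<rhd> a') p' @ q') when a = a')"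
proof -
  let ?n = "length p + length q"
  have words: "p @ a # q \<in> words Q (Suc ?n)" "p' @ a' # q' \<in> words Q (Suc ?n)"
    "p @ q \<in> words Q ?n" "map (\<lambda>x. x \<rhd> a) p @ q \<in> words Q ?n"
    using assms by (auto simp: words_def)
  have "f (basis (p @ q)) \<in> tensors \<mm> Q ?n"
    by (intro cochainD [OF f] basis_in_tensors words)
  then have keys: "Poly_Mapping.keys (f (basis (p @ q))) \<subseteq> {w. length w = ?n}"
    by (auto simp: tensors_def words_def)
  have keys': "Poly_Mapping.keys (basis [a] :: ('q, 'a) tensor) \<subseteq> {w. length w = 1}"
    by (auto simp: in_keys_iff lookup_basis when_def split: if_splits)
  have R: "right_word op (length p) (p' @ a' # q') = (p' @ q') @ [foldl op a' q']"
    and L: "left_word op (length p) (p' @ a' # q') = a' # map (\<lambda>x. x \<rhd> a') p' @ q'"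
    using right_word_split [of op p' a' q'] left_word_split [of op p' a' q'] len by simp_all
  have "Poly_Mapping.lookup (tensor_map ?n f id
        (right_braid op ?n (length p) (basis (p @ a # q)))) ((p' @ q') @ [foldl op a' q'])
      = (coef f (p @ q) (p' @ q') when foldl op a q = foldl op a' q')"
    using lookup_tensor_prod [OF keys, of "basis [foldl op a q]"
        "(p' @ q') @ [foldl op a' q']"] len
    by (simp add: right_braid_basis tensor_map_basis coef_def lookup_basis when_def)
  moreover have "Poly_Mapping.lookup (tensor_map 1 id f
        (left_braid op (length p) (basis (p @ a # q)))) (a' # map (\<lambda>x. x \<rhd> a') p' @ q')
      = (coef f (map (\<lambda>x. x \<rhd> a) p @ q) (map (\<lambda>x. x \<rhd> a') p' @ q') when a = a')"
    using lookup_tensor_prod [OF keys']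
    by (simp add: left_braid_basis tensor_map_basis coef_def lookup_basis when_def)
  ultimately show ?thesis
    using lookup_partial_coboundary [OF f _ basis_in_tensors [OF words(1)] words(2)]
    by (simp add: coef_def R L)
qed

section \<open>The entropic submodule\<close>

lemma partial_coboundary_add:
  assumes "f \<in> cochains \<mm> Q n" "g \<in> cochains \<mm> Q n" "i \<le> n"
  shows "partial_coboundary Q op n i (f + g)
    = partial_coboundary Q op n i f + partial_coboundary Q op n i g"
proof (rule cochain_eqI)
  show "partial_coboundary Q op n i (f + g) \<in> cochains \<mm> Q (Suc n)"
    and "partial_coboundary Q op n i f + partial_coboundary Q op n i g \<in> cochains \<mm> Q (Suc n)"
    by (intro partial_coboundary_in_cochains cochains_add assms)+
  fix x y
  assume x: "x \<in> words Q (Suc n)" and y: "y \<in> words Q (Suc n)"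
  obtain p a q where xs: "x = p @ a # q" "length p = i" "length q = n - i"
    "set p \<subseteq> Q" "a \<in> Q" "set q \<subseteq> Q"
    by (rule words_splitE [OF x assms(3)])
  obtain p' a' q' where ys: "y = p' @ a' # q'" "length p' = i" "length q' = n - i"
    "set p' \<subseteq> Q" "a' \<in> Q" "set q' \<subseteq> Q"
    by (rule words_splitE [OF y assms(3)])
  have n: "n = length p + length q"
    using xs assms(3) by simp
  show "coef (partial_coboundary Q op n i (f + g)) x y
      = coef (partial_coboundary Q op n i f + partial_coboundary Q op n i g) x y"
    using xs ys assms(1,2) coef_partial_coboundary [of _ p q a p' a' q'] cochains_add [OF assms(1,2)]
    unfolding n by (simp add: when_def)
qed

lemma partial_coboundary_scale:
  assumes "f \<in> cochains \<mm> Q n" "i \<le> n"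
  shows "partial_coboundary Q op n i (cochain_scale r f)
    = cochain_scale r (partial_coboundary Q op n i f)"
proof (rule cochain_eqI)
  show "partial_coboundary Q op n i (cochain_scale r f) \<in> cochains \<mm> Q (Suc n)"
    and "cochain_scale r (partial_coboundary Q op n i f) \<in> cochains \<mm> Q (Suc n)"
    by (intro partial_coboundary_in_cochains cochains_scale assms)+
  fix x y
  assume x: "x \<in> words Q (Suc n)" and y: "y \<in> words Q (Suc n)"
  obtain p a q where xs: "x = p @ a # q" "length p = i" "length q = n - i"
    "set p \<subseteq> Q" "a \<in> Q" "set q \<subseteq> Q"
    by (rule words_splitE [OF x assms(2)])
  obtain p' a' q' where ys: "y = p' @ a' # q'" "length p' = i" "length q' = n - i"
    "set p' \<subseteq> Q" "a' \<in> Q" "set q' \<subseteq> Q"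
    by (rule words_splitE [OF y assms(2)])
  have n: "n = length p + length q"
    using xs assms(2) by simp
  show "coef (partial_coboundary Q op n i (cochain_scale r f)) x y
      = coef (cochain_scale r (partial_coboundary Q op n i f)) x y"
    using xs ys assms(1) coef_partial_coboundary [of _ p q a p' a' q'] cochains_scale [OF assms(1)]
    unfolding n by (simp add: when_def right_diff_distrib)
qed

lemma partial_coboundary_zero: "i \<le> n \<Longrightarrow> partial_coboundary Q op n i (0 :: ('q, 'a) cochain) = 0"
  using partial_coboundary_scale [OF cochains_zero, of i n 0] by simp

lemma coboundary_in_cochains:
  "f \<in> cochains \<mm> Q n \<Longrightarrow> coboundary Q op n f \<in> cochains \<mm> Q (Suc n)"
  unfolding coboundary_def
  by (intro cochains_sum cochains_scale partial_coboundary_in_cochains) auto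

lemma coboundary_add:
  assumes "f \<in> cochains \<mm> Q n" "g \<in> cochains \<mm> Q n"
  shows "coboundary Q op n (f + g) = coboundary Q op n f + coboundary Q op n g"
  unfolding coboundary_def sum.distrib [symmetric]
  by (rule sum.cong) (simp_all add: partial_coboundary_add assms cochain_scale_add)

lemma coboundary_scale:
  assumes "f \<in> cochains \<mm> Q n"
  shows "coboundary Q op n (cochain_scale r f) = cochain_scale r (coboundary Q op n f)"
  unfolding coboundary_def cochain_scale_sum
  by (rule sum.cong) (simp_all add: partial_coboundary_scale assms cochain_scale_commute)

lemma coboundary_zero: "coboundary Q op n (0 :: ('q, 'a) cochain) = 0"
  using coboundary_scale [OF cochains_zero, of n 0] by simp

lemma coboundary_sum:
  assumes "\<And>s. s \<in> S \<Longrightarrow> F s \<in> cochains \<mm> Q n"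
  shows "coboundary Q op n (sum F S) = (\<Sum>s\<in>S. coboundary Q op n (F s))"
  using assms
proof (induction S rule: infinite_finite_induct)
  case (insert s S)
  then show ?case
    using coboundary_add [of "F s" n "sum F S"] cochains_sum [of S F n] by (metis insertCI sum.insert)
next
  case (infinite S)
  then show ?case
    by (simp only: sum.infinite [OF infinite(1)] coboundary_zero)
qed (simp only: sum.empty coboundary_zero)

lemma entropic_submodule:
  "cochain_submodule (entropic_cochains \<mm> Q op n) (cocycles \<mm> Q op n)"
  unfolding cochain_submodule_def
proof (intro conjI subsetI ballI allI)
  fix f
  assume "f \<in> entropic_cochains \<mm> Q op n"
  then have f: "f \<in> cochains \<mm> Q n" "\<And>i. i \<le> n \<Longrightarrow> partial_coboundary Q op n i f = 0"
    by (auto simp: entropic_cochains_def)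
  have "coboundary Q op n f = (\<Sum>i\<le>n. 0)"
    unfolding coboundary_def by (rule sum.cong) (simp_all only: f atMost_iff cochain_scale_zero)
  then show "f \<in> cocycles \<mm> Q op n"
    using f by (simp add: cocycles_def)
next
  show "0 \<in> entropic_cochains \<mm> Q op n"
    by (simp add: entropic_cochains_def cochains_zero partial_coboundary_zero)
qed (simp_all add: entropic_cochains_def cochains_add cochains_scale
    partial_coboundary_add partial_coboundary_scale)

section \<open>Coefficients in low degrees\<close>

lemma words_1: "w \<in> words Q (Suc 0) \<longleftrightarrow> (\<exists>x\<in>Q. w = [x])"
  and words_2: "w \<in> words Q 2 \<longleftrightarrow> (\<exists>x\<in>Q. \<exists>y\<in>Q. w = [x, y])"
  and words_3: "w \<in> words Q 3 \<longleftrightarrow> (\<exists>x\<in>Q. \<exists>y\<in>Q. \<exists>z\<in>Q. w = [x, y, z])"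
  by (auto simp: words_def length_Suc_conv numeral_2_eq_2 numeral_3_eq_3)

lemma coef_coboundary_1:
  assumes "g \<in> cochains \<mm> Q (Suc 0)" "x \<in> Q" "y \<in> Q" "u \<in> Q" "v \<in> Q"
  shows "coef (coboundary Q op (Suc 0) g) [x, y] [u, v]
    = (coef g [y] [v] when x \<rhd> y = u \<rhd> v) - (coef g [y] [v] when x = u)
      - (coef g [x] [u] when y = v) + (coef g [x \<rhd> y] [u \<rhd> v] when y = v)"
proof -
  have "coef (partial_coboundary Q op (Suc 0) 0 g) [x, y] [u, v]
      = (coef g [y] [v] when x \<rhd> y = u \<rhd> v) - (coef g [y] [v] when x = u)"
    using coef_partial_coboundary [of g "[]" "[y]" x "[]" u "[v]"] assms by simp
  moreover have "coef (partial_coboundary Q op (Suc 0) (Suc 0) g) [x, y] [u, v]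
      = (coef g [x] [u] when y = v) - (coef g [x \<rhd> y] [u \<rhd> v] when y = v)"
    using coef_partial_coboundary [of g "[x]" "[]" y "[u]" v "[]"] assms by simp
  ultimately show ?thesis
    by (simp add: coboundary_def algebra_simps)
qed

lemma
  assumes "f \<in> cochains \<mm> Q 2" "x \<in> Q" "y \<in> Q" "z \<in> Q" "u \<in> Q" "v \<in> Q" "w \<in> Q"
  shows coef_partial_0: "coef (partial_coboundary Q op 2 0 f) [x, y, z] [u, v, w]
      = (coef f [y, z] [v, w] when x \<rhd> y \<rhd> z = u \<rhd> v \<rhd> w) - (coef f [y, z] [v, w] when x = u)"
    and coef_partial_1: "coef (partial_coboundary Q op 2 (Suc 0) f) [x, y, z] [u, v, w]
      = (coef f [x, z] [u, w] when y \<rhd> z = v \<rhd> w)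
        - (coef f [x \<rhd> y, z] [u \<rhd> v, w] when y = v)"
    and coef_partial_2: "coef (partial_coboundary Q op 2 2 f) [x, y, z] [u, v, w]
      = (coef f [x, y] [u, v] when z = w)
        - (coef f [x \<rhd> z, y \<rhd> z] [u \<rhd> w, v \<rhd> w] when z = w)"
  using coef_partial_coboundary [of f "[]" "[y, z]" x "[]" u "[v, w]"]
    coef_partial_coboundary [of f "[x]" "[z]" y "[u]" v "[w]"]
    coef_partial_coboundary [of f "[x, y]" "[]" z "[u, v]" w "[]"] assms
  by (simp_all add: numeral_2_eq_2)

lemma coef_coboundary_2:
  "coef (coboundary Q op 2 f) x y = coef (partial_coboundary Q op 2 0 f) x y
    - coef (partial_coboundary Q op 2 (Suc 0) f) x y + coef (partial_coboundary Q op 2 2 f) x y"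
  by (simp add: coboundary_def numeral_2_eq_2)

text \<open>
  The condition on a cocycle in coordinates; every later statement about cocycles is an instance of
  this equation for well chosen letters.
\<close>

lemma cocycle_equation:
  assumes "f \<in> cocycles \<mm> Q op 2" "x \<in> Q" "y \<in> Q" "z \<in> Q" "u \<in> Q" "v \<in> Q" "w \<in> Q"
  shows "(coef f [y, z] [v, w] when x \<rhd> y \<rhd> z = u \<rhd> v \<rhd> w) - (coef f [y, z] [v, w] when x = u)
    - (coef f [x, z] [u, w] when y \<rhd> z = v \<rhd> w) + (coef f [x \<rhd> y, z] [u \<rhd> v, w] when y = v)
    + (coef f [x, y] [u, v] when z = w) - (coef f [x \<rhd> z, y \<rhd> z] [u \<rhd> w, v \<rhd> w] when z = w) = 0"
proof -
  have f: "f \<in> cochains \<mm> Q 2" "coboundary Q op 2 f = 0"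
    using assms(1) by (auto simp: cocycles_def)
  have "coef (coboundary Q op 2 f) [x, y, z] [u, v, w] = 0"
    unfolding f(2) by (rule coef_zero)
  then show ?thesis
    using f(1) assms(2-) by (simp add: coef_coboundary_2 coef_partial_0 coef_partial_1 coef_partial_2
        algebra_simps)
qed

text \<open>
  The terms cancel by self-distributivity, \<open>(x \<rhd> z) \<rhd> (y \<rhd> z) = x \<rhd> y \<rhd> z\<close>: it reduces the
  question of whether letters agree after two actions to whether they agree after one.
\<close>

lemma coboundary_coboundary:
  assumes g: "g \<in> cochains \<mm> Q (Suc 0)"
  shows "coboundary Q op 2 (coboundary Q op (Suc 0) g) = 0"
proof (rule cochain_eqI)
  have dg: "coboundary Q op (Suc 0) g \<in> cochains \<mm> Q 2"
    using coboundary_in_cochains [OF g] by (simp add: numeral_2_eq_2)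
  show "coboundary Q op 2 (coboundary Q op (Suc 0) g) \<in> cochains \<mm> Q 3"
    using coboundary_in_cochains [OF dg] by (simp add: numeral_3_eq_3 numeral_2_eq_2)
  show "0 \<in> cochains \<mm> Q 3"
    by (rule cochains_zero)
  fix a b
  assume "a \<in> words Q 3" "b \<in> words Q 3"
  then obtain x y z u v w where ab: "a = [x, y, z]" "b = [u, v, w]"
    and Q: "x \<in> Q" "y \<in> Q" "z \<in> Q" "u \<in> Q" "v \<in> Q" "w \<in> Q"
    unfolding words_3 by blast
  have dist: "x \<rhd> z \<rhd> (y \<rhd> z) = x \<rhd> y \<rhd> z" "u \<rhd> w \<rhd> (v \<rhd> w) = u \<rhd> v \<rhd> w"
    using Q op_dist by metis+
  then have "y \<rhd> z = v \<rhd> w \<Longrightarrow> x \<rhd> y \<rhd> z = u \<rhd> v \<rhd> w \<longleftrightarrow> x \<rhd> z = u \<rhd> w"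
    using Q op_cancel op_closed by metis
  then have "coef (coboundary Q op 2 (coboundary Q op (Suc 0) g)) [x, y, z] [u, v, w] = 0"
    using Q dist
    by (cases "z = w"; cases "y = v"; cases "y \<rhd> z = v \<rhd> w"; cases "x = u")
      (simp_all add: coef_coboundary_2 coef_partial_0 [OF dg] coef_partial_1 [OF dg]
        coef_partial_2 [OF dg] coef_coboundary_1 [OF g] when_def)
  then show "coef (coboundary Q op 2 (coboundary Q op (Suc 0) g)) a b = coef 0 a b"
    unfolding ab by simp
qed

lemma coboundaries_2: "coboundaries \<mm> Q op 2 = coboundary Q op (Suc 0) ` cochains \<mm> Q (Suc 0)"
  by (simp add: coboundaries_def)

lemma coboundary_cocycle:
  assumes "g \<in> cochains \<mm> Q (Suc 0)"
  shows "coboundary Q op (Suc 0) g \<in> cocycles \<mm> Q op 2"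
  using coboundary_in_cochains [OF assms] coboundary_coboundary [OF assms]
  by (simp add: cocycles_def numeral_2_eq_2)

lemma coboundaries_submodule:
  "cochain_submodule (coboundaries \<mm> Q op 2) (cocycles \<mm> Q op 2)"
  unfolding cochain_submodule_def coboundaries_2
proof (intro conjI ballI allI)
  show "coboundary Q op (Suc 0) ` cochains \<mm> Q (Suc 0) \<subseteq> cocycles \<mm> Q op 2"
    using coboundary_cocycle by blast
  show "0 \<in> coboundary Q op (Suc 0) ` cochains \<mm> Q (Suc 0)"
    by (metis coboundary_zero cochains_zero imageI)
qed (auto simp flip: coboundary_add coboundary_scale intro: cochains_add cochains_scale)

lemma cocycles_add:
  "f \<in> cocycles \<mm> Q op n \<Longrightarrow> g \<in> cocycles \<mm> Q op n \<Longrightarrow> f + g \<in> cocycles \<mm> Q op n"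
  by (simp add: cocycles_def cochains_add coboundary_add)

lemma cochain_1_with_coefs:
  assumes "\<And>x. x \<in> Q \<Longrightarrow> finite {u \<in> Q. c x u \<noteq> 0}"
    and "\<And>x u. x \<in> Q \<Longrightarrow> u \<in> Q \<Longrightarrow> c x u \<in> \<mm>"
  obtains g where "g \<in> cochains \<mm> Q (Suc 0)"
    "\<And>x u. x \<in> Q \<Longrightarrow> u \<in> Q \<Longrightarrow> coef g [x] [u] = c x u"
proof -
  let ?c = "\<lambda>x y. c (hd x) (hd y) when y \<in> words Q (Suc 0)"
  show thesis
  proof (rule cochain_with_coefs [of "Suc 0" ?c])
    fix x
    assume x: "x \<in> words Q (Suc 0)"
    show "finite {y. ?c x y \<noteq> 0}"
    proof (rule finite_subset)
      show "{y. ?c x y \<noteq> 0} \<subseteq> (\<lambda>u. [u]) ` {u \<in> Q. c (hd x) u \<noteq> 0}"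
        by (auto simp: words_1)
      show "finite ((\<lambda>u. [u]) ` {u \<in> Q. c (hd x) u \<noteq> 0})"
        using x assms(1) by (auto simp: words_1)
    qed
    show "?c x y \<in> \<mm>" for y
      using x assms(2) ideal by (auto simp: words_1 when_def ring_ideal_def)
    show "?c x y = 0" if "y \<notin> words Q (Suc 0)" for y
      using that by simp
  next
    fix g
    assume g: "g \<in> cochains \<mm> Q (Suc 0)" "\<And>x y. x \<in> words Q (Suc 0) \<Longrightarrow> coef g x y = ?c x y"
    show thesis
      by (rule that [OF g(1)]) (simp add: g(2) words_1)
  qed
qed

section \<open>Inner automorphisms act trivially on cohomology\<close>

lemma rack_Aut_subgroup: "subgroup (carrier (rack_Aut Q op)) (BijGroup Q)"
proof -
  interpret group "BijGroup Q"
    by (rule group_BijGroup)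
  show ?thesis
  proof (rule subgroupI)
    show "carrier (rack_Aut Q op) \<subseteq> carrier (BijGroup Q)"
      by (auto simp: rack_Aut_def BijGroup_def)
    have "(\<lambda>x\<in>Q. x) \<in> carrier (rack_Aut Q op)"
      by (simp add: rack_Aut_def id_Bij)
    then show "carrier (rack_Aut Q op) \<noteq> {}"
      by blast
  next
    fix h
    assume "h \<in> carrier (rack_Aut Q op)"
    then have h: "h \<in> Bij Q" "\<And>x y. x \<in> Q \<Longrightarrow> y \<in> Q \<Longrightarrow> h (op x y) = op (h x) (h y)"
      by (auto simp: rack_Aut_def)
    have "inv_into Q h (op x y) = op (inv_into Q h x) (inv_into Q h y)" if "x \<in> Q" "y \<in> Q" for x y
      by (rule Bij_inv_into_lemma) (use h that in auto)
    then show "inv\<^bsub>BijGroup Q\<^esub> h \<in> carrier (rack_Aut Q op)"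
      using h by (simp add: rack_Aut_def inv_BijGroup restrict_inv_into_Bij)
  next
    fix h k
    assume "h \<in> carrier (rack_Aut Q op)" "k \<in> carrier (rack_Aut Q op)"
    moreover have "k x \<in> Q" if "x \<in> Q" for x
      using calculation that by (auto simp: rack_Aut_def dest: Bij_imp_funcset)
    ultimately show "h \<otimes>\<^bsub>BijGroup Q\<^esub> k \<in> carrier (rack_Aut Q op)"
      using compose_Bij [of h Q k] by (simp add: rack_Aut_def BijGroup_def compose_def)
  qed
qed

lemma group_rack_Aut: "group (rack_Aut Q op)"
  using subgroup.subgroup_is_group [OF rack_Aut_subgroup group_BijGroup]
  by (simp add: rack_Aut_def)

lemma rack_AutD:
  assumes "h \<in> carrier (rack_Aut Q op)"
  shows "x \<in> Q \<Longrightarrow> h x \<in> Q" "inj_on h Q"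
    "x \<in> Q \<Longrightarrow> y \<in> Q \<Longrightarrow> h (x \<rhd> y) = h x \<rhd> h y"
  using assms Bij_imp_funcset [of h Q] by (auto simp: rack_Aut_def Bij_def bij_betw_def)

lemma rack_Aut_mult:
  assumes "h \<in> carrier (rack_Aut Q op)" "k \<in> carrier (rack_Aut Q op)" "x \<in> Q"
  shows "(h \<otimes>\<^bsub>rack_Aut Q op\<^esub> k) x = h (k x)"
  using assms by (simp add: rack_Aut_def BijGroup_def compose_def)

lemma rack_Aut_one: "x \<in> Q \<Longrightarrow> \<one>\<^bsub>rack_Aut Q op\<^esub> x = x"
  by (simp add: rack_Aut_def BijGroup_def)

lemma right_translation_apply [simp]: "x \<in> Q \<Longrightarrow> right_translation Q op z x = x \<rhd> z"
  by (simp add: right_translation_def)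

lemma right_translation_Aut:
  assumes "z \<in> Q"
  shows "right_translation Q op z \<in> carrier (rack_Aut Q op)"
  using op_bij [OF assms]
  by (simp add: rack_Aut_def Bij_def right_translation_def bij_betw_def op_dist [OF _ _ assms])

lemma carrier_Inn:
  "carrier (Inn Q op) = generate (rack_Aut Q op) (right_translation Q op ` Q)"
proof -
  have "carrier (rack_Aut Q op) \<inter> right_translation Q op ` Q = right_translation Q op ` Q"
    using right_translation_Aut by blast
  then show ?thesis
    by (simp add: Inn_def carrier_subgroup_generated)
qed

lemma group_Inn: "group (Inn Q op)"
  unfolding Inn_def using group_rack_Aut by (rule group.group_subgroup_generated)

lemma Inn_mult: "mult (Inn Q op) = mult (rack_Aut Q op)"
  by (simp add: Inn_def)

lemma Inn_one: "\<one>\<^bsub>Inn Q op\<^esub> = \<one>\<^bsub>rack_Aut Q op\<^esub>"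
  by (simp add: Inn_def)

lemma Inn_Aut: "h \<in> carrier (Inn Q op) \<Longrightarrow> h \<in> carrier (rack_Aut Q op)"
  unfolding Inn_def using group.carrier_subgroup_generated_subset [OF group_rack_Aut] by blast

lemma right_translation_Inn: "z \<in> Q \<Longrightarrow> right_translation Q op z \<in> carrier (Inn Q op)"
  unfolding carrier_Inn by (simp add: generate.incl)

text \<open>
  Triviality of the action of \<open>h\<close> on the cohomology of degree two. Comparing coefficients avoids a
  separate construction of the cochain to which \<open>h\<close> transforms \<open>f\<close>.
\<close>

definition acts_trivially :: "('q \<Rightarrow> 'q) \<Rightarrow> bool" where
  "acts_trivially h \<longleftrightarrow> (\<forall>f\<in>cocycles \<mm> Q op 2. \<exists>k\<in>cochains \<mm> Q (Suc 0).
    \<forall>x\<in>Q. \<forall>y\<in>Q. \<forall>u\<in>Q. \<forall>v\<in>Q. coef f [h x, h y] [h u, h v]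
      = coef f [x, y] [u, v] + coef (coboundary Q op (Suc 0) k) [x, y] [u, v])"

text \<open>
  Freezing the last letter is a homotopy: in the cocycle equation with \<open>w = z\<close>, the partial
  coboundaries other than the last one turn into those of the frozen cochain, and the last one is the
  difference between \<open>f\<close> and its translate.
\<close>

lemma acts_trivially_right_translation:
  assumes "z \<in> Q"
  shows "acts_trivially (right_translation Q op z)"
  unfolding acts_trivially_def
proof
  fix f
  assume f: "f \<in> cocycles \<mm> Q op 2"
  then have f2: "f \<in> cochains \<mm> Q 2"
    by (simp add: cocycles_def)
  obtain k where k: "k \<in> cochains \<mm> Q (Suc 0)"
    "\<And>x u. x \<in> Q \<Longrightarrow> u \<in> Q \<Longrightarrow> coef k [x] [u] = coef f [x, z] [u, z]"
  proof (rule cochain_1_with_coefs [of "\<lambda>x u. coef f [x, z] [u, z]"])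
    show "finite {u \<in> Q. coef f [x, z] [u, z] \<noteq> 0}" for x
      by (rule finite_coef_row) (simp add: inj_on_def)
    show "coef f [x, z] [u, z] \<in> \<mm>" if "x \<in> Q" for x u
      using f2 by (rule coef_in_ideal) (use that assms in \<open>simp add: words_2\<close>)
  qed (rule that)
  have "coef f [x \<rhd> z, y \<rhd> z] [u \<rhd> z, v \<rhd> z]
      = coef f [x, y] [u, v] + coef (coboundary Q op (Suc 0) k) [x, y] [u, v]"
    if "x \<in> Q" "y \<in> Q" "u \<in> Q" "v \<in> Q" for x y u v
    using cocycle_equation [OF f that(1,2) assms that(3,4) assms] that assms
    by (simp add: coef_coboundary_1 k algebra_simps)
  with k(1) show "\<exists>k\<in>cochains \<mm> Q (Suc 0). \<forall>x\<in>Q. \<forall>y\<in>Q. \<forall>u\<in>Q. \<forall>v\<in>Q.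
      coef f [right_translation Q op z x, right_translation Q op z y]
        [right_translation Q op z u, right_translation Q op z v]
      = coef f [x, y] [u, v] + coef (coboundary Q op (Suc 0) k) [x, y] [u, v]"
    by (intro bexI [of _ k]) auto
qed

text \<open>
  Substituting the images under \<open>h'\<close> into the relation for \<open>h\<close> gives the relation for \<open>h'\<close>. The
  primitive becomes the negative of its transform under \<open>h'\<close>, because the coboundary is equivariant
  under automorphisms.
\<close>

lemma acts_trivially_inverse:
  assumes "h \<in> carrier (rack_Aut Q op)" "h' \<in> carrier (rack_Aut Q op)"
    and inverse: "\<And>x. x \<in> Q \<Longrightarrow> h (h' x) = x"
    and "acts_trivially h"
  shows "acts_trivially h'"
  unfolding acts_trivially_def
proof
  fix f
  assume f: "f \<in> cocycles \<mm> Q op 2"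
  note h' = rack_AutD [OF assms(2)]
  obtain k where k: "k \<in> cochains \<mm> Q (Suc 0)"
    "\<And>x y u v. x \<in> Q \<Longrightarrow> y \<in> Q \<Longrightarrow> u \<in> Q \<Longrightarrow> v \<in> Q \<Longrightarrow> coef f [h x, h y] [h u, h v]
      = coef f [x, y] [u, v] + coef (coboundary Q op (Suc 0) k) [x, y] [u, v]"
    using assms(4) f unfolding acts_trivially_def by blast
  obtain k' where k': "k' \<in> cochains \<mm> Q (Suc 0)"
    "\<And>x u. x \<in> Q \<Longrightarrow> u \<in> Q \<Longrightarrow> coef k' [x] [u] = - coef k [h' x] [h' u]"
  proof (rule cochain_1_with_coefs [of "\<lambda>x u. - coef k [h' x] [h' u]"])
    have "inj_on (\<lambda>u. [h' u]) Q"
      using h'(2) by (simp add: inj_on_def)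
    from finite_coef_row [OF this] show "finite {u \<in> Q. - coef k [h' x] [h' u] \<noteq> 0}" for x
      by simp
    show "- coef k [h' x] [h' u] \<in> \<mm>" if "x \<in> Q" for x u
      using ideal_mult(1) [OF coef_in_ideal [OF k(1)], of "[h' x]" "- 1" "[h' u]"] that h'
      by (simp add: words_1)
  qed (rule that)
  have "coef f [h' x, h' y] [h' u, h' v]
      = coef f [x, y] [u, v] + coef (coboundary Q op (Suc 0) k') [x, y] [u, v]"
    if Q: "x \<in> Q" "y \<in> Q" "u \<in> Q" "v \<in> Q" for x y u v
  proof -
    have eq: "h' a = h' b \<longleftrightarrow> a = b" if "a \<in> Q" "b \<in> Q" for a b
      using h'(2) that by (rule inj_on_eq_iff)
    have "coef (coboundary Q op (Suc 0) k') [x, y] [u, v]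
        = - coef (coboundary Q op (Suc 0) k) [h' x, h' y] [h' u, h' v]"
      using Q h'(1)
      by (simp add: coef_coboundary_1 k(1) k' eq flip: h'(3)) (simp add: when_def)
    moreover have "coef f [x, y] [u, v] = coef f [h' x, h' y] [h' u, h' v]
        + coef (coboundary Q op (Suc 0) k) [h' x, h' y] [h' u, h' v]"
      using k(2) [of "h' x" "h' y" "h' u" "h' v"] Q h'(1) by (simp add: inverse)
    ultimately show ?thesis
      by simp
  qed
  with k'(1) show "\<exists>k\<in>cochains \<mm> Q (Suc 0). \<forall>x\<in>Q. \<forall>y\<in>Q. \<forall>u\<in>Q. \<forall>v\<in>Q.
      coef f [h' x, h' y] [h' u, h' v]
      = coef f [x, y] [u, v] + coef (coboundary Q op (Suc 0) k) [x, y] [u, v]"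
    by blast
qed

text \<open>
  After \<open>h\<close> has changed \<open>f\<close> by a coboundary, the result is again a cocycle, to which the triviality of
  \<open>h'\<close> applies.
\<close>

lemma acts_trivially_mult:
  assumes "h \<in> carrier (rack_Aut Q op)" "h' \<in> carrier (rack_Aut Q op)"
    and "acts_trivially h" "acts_trivially h'"
  shows "acts_trivially (h \<otimes>\<^bsub>rack_Aut Q op\<^esub> h')"
  unfolding acts_trivially_def
proof
  fix f
  assume f: "f \<in> cocycles \<mm> Q op 2"
  obtain k where k: "k \<in> cochains \<mm> Q (Suc 0)"
    "\<And>x y u v. x \<in> Q \<Longrightarrow> y \<in> Q \<Longrightarrow> u \<in> Q \<Longrightarrow> v \<in> Q \<Longrightarrow> coef f [h x, h y] [h u, h v]
      = coef f [x, y] [u, v] + coef (coboundary Q op (Suc 0) k) [x, y] [u, v]"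
    using assms(3) f unfolding acts_trivially_def by blast
  have "f + coboundary Q op (Suc 0) k \<in> cocycles \<mm> Q op 2"
    by (intro cocycles_add f coboundary_cocycle k)
  then obtain k' where k': "k' \<in> cochains \<mm> Q (Suc 0)"
    "\<And>x y u v. x \<in> Q \<Longrightarrow> y \<in> Q \<Longrightarrow> u \<in> Q \<Longrightarrow> v \<in> Q \<Longrightarrow>
      coef (f + coboundary Q op (Suc 0) k) [h' x, h' y] [h' u, h' v]
      = coef (f + coboundary Q op (Suc 0) k) [x, y] [u, v]
        + coef (coboundary Q op (Suc 0) k') [x, y] [u, v]"
    using assms(4) unfolding acts_trivially_def by blast
  show "\<exists>k\<in>cochains \<mm> Q (Suc 0). \<forall>x\<in>Q. \<forall>y\<in>Q. \<forall>u\<in>Q. \<forall>v\<in>Q.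
      coef f [(h \<otimes>\<^bsub>rack_Aut Q op\<^esub> h') x, (h \<otimes>\<^bsub>rack_Aut Q op\<^esub> h') y]
        [(h \<otimes>\<^bsub>rack_Aut Q op\<^esub> h') u, (h \<otimes>\<^bsub>rack_Aut Q op\<^esub> h') v]
      = coef f [x, y] [u, v] + coef (coboundary Q op (Suc 0) k) [x, y] [u, v]"
  proof (intro bexI ballI)
    show "k + k' \<in> cochains \<mm> Q (Suc 0)"
      by (intro cochains_add k k')
    fix x y u v
    assume Q: "x \<in> Q" "y \<in> Q" "u \<in> Q" "v \<in> Q"
    then show "coef f [(h \<otimes>\<^bsub>rack_Aut Q op\<^esub> h') x, (h \<otimes>\<^bsub>rack_Aut Q op\<^esub> h') y]
        [(h \<otimes>\<^bsub>rack_Aut Q op\<^esub> h') u, (h \<otimes>\<^bsub>rack_Aut Q op\<^esub> h') v]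
        = coef f [x, y] [u, v] + coef (coboundary Q op (Suc 0) (k + k')) [x, y] [u, v]"
      using k'(2) [OF Q] rack_AutD(1) [OF assms(2)]
      by (simp add: rack_Aut_mult [OF assms(1,2)] k(2) coboundary_add [OF k(1) k'(1)] add.assoc)
  qed
qed

lemma Inn_acts_trivially:
  assumes "h \<in> carrier (Inn Q op)"
  shows "acts_trivially h"
proof -
  have Aut: "h \<in> carrier (rack_Aut Q op)"
    if "h \<in> generate (rack_Aut Q op) (right_translation Q op ` Q)" for h
    using that Inn_Aut unfolding carrier_Inn by blast
  show ?thesis
    using assms unfolding carrier_Inn
  proof (induction h rule: generate.induct)
    case one
    show ?case
      unfolding acts_trivially_def
      by (intro ballI bexI [of _ 0]) (simp_all add: rack_Aut_one coboundary_zero cochains_zero)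
  next
    case (incl h)
    then show ?case
      using acts_trivially_right_translation by blast
  next
    case (inv h)
    then have h: "h \<in> carrier (rack_Aut Q op)" "acts_trivially h"
      using right_translation_Aut acts_trivially_right_translation by auto
    note h' = group.inv_closed [OF group_rack_Aut h(1)]
    show ?case
    proof (rule acts_trivially_inverse [OF h(1) h' _ h(2)])
      fix x
      assume x: "x \<in> Q"
      then show "h ((inv\<^bsub>rack_Aut Q op\<^esub> h) x) = x"
        using group.r_inv [OF group_rack_Aut h(1)] by (metis rack_Aut_mult [OF h(1) h' x] rack_Aut_one)
    qed
  next
    case (eng h1 h2)
    then show ?case
      by (simp add: acts_trivially_mult Aut)
  qed
qed

section \<open>Averaging\<close>

definition invariant :: "('q, 'a) cochain \<Rightarrow> bool" where
  "invariant f \<longleftrightarrow> (\<forall>x\<in>Q. \<forall>y\<in>Q. \<forall>u\<in>Q. \<forall>v\<in>Q. \<forall>z\<in>Q.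
     coef f [x \<rhd> z, y \<rhd> z] [u \<rhd> z, v \<rhd> z] = coef f [x, y] [u, v])"

text \<open>
  With primitives \<open>K h\<close> for all inner automorphisms \<open>h\<close>, adding the coboundary of their mean to \<open>f\<close>
  gives the mean of the transforms of \<open>f\<close>. A right translation permutes the summands of this mean.
\<close>

lemma cohomologous_invariant:
  assumes invertible: "order_invertible (Inn Q op) TYPE('a)" and f: "f \<in> cocycles \<mm> Q op 2"
  obtains k where "k \<in> cochains \<mm> Q (Suc 0)" "invariant (f + coboundary Q op (Suc 0) k)"
proof -
  let ?G = "carrier (Inn Q op)"
  obtain r where fin: "finite ?G" and r: "(\<Sum>h\<in>?G. 1) * r = (1 :: 'a)"
    using invertible unfolding order_invertible_def order_def by (auto simp only: sum_one_card)
  have "\<forall>h\<in>?G. \<exists>k. k \<in> cochains \<mm> Q (Suc 0) \<and>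
      (\<forall>x\<in>Q. \<forall>y\<in>Q. \<forall>u\<in>Q. \<forall>v\<in>Q. coef f [h x, h y] [h u, h v]
        = coef f [x, y] [u, v] + coef (coboundary Q op (Suc 0) k) [x, y] [u, v])"
    using Inn_acts_trivially f unfolding acts_trivially_def by blast
  from bchoice [OF this] obtain K where K: "\<And>h. h \<in> ?G \<Longrightarrow> K h \<in> cochains \<mm> Q (Suc 0)"
    "\<And>h x y u v. h \<in> ?G \<Longrightarrow> x \<in> Q \<Longrightarrow> y \<in> Q \<Longrightarrow> u \<in> Q \<Longrightarrow> v \<in> Q \<Longrightarrow> coef f [h x, h y] [h u, h v]
      = coef f [x, y] [u, v] + coef (coboundary Q op (Suc 0) (K h)) [x, y] [u, v]"
    by blast
  define k where "k = cochain_scale r (\<Sum>h\<in>?G. K h)"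
  have sum: "(\<Sum>h\<in>?G. K h) \<in> cochains \<mm> Q (Suc 0)"
    by (intro cochains_sum K)
  have dk: "coboundary Q op (Suc 0) k
      = cochain_scale r (\<Sum>h\<in>?G. coboundary Q op (Suc 0) (K h))"
    unfolding k_def by (simp only: coboundary_scale [OF sum] coboundary_sum [OF K(1)])
  have average: "coef (f + coboundary Q op (Suc 0) k) [x, y] [u, v]
      = r * (\<Sum>h\<in>?G. coef f [h x, h y] [h u, h v])"
    if Q: "x \<in> Q" "y \<in> Q" "u \<in> Q" "v \<in> Q" for x y u v
  proof -
    have "coef f [x, y] [u, v] = r * (\<Sum>h\<in>?G. 1) * coef f [x, y] [u, v]"
      using r by (simp add: mult.commute)
    also have "\<dots> = r * (\<Sum>h\<in>?G. coef f [x, y] [u, v])"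
      by (simp only: mult.assoc sum_distrib_right mult_1_left)
    finally have "coef (f + coboundary Q op (Suc 0) k) [x, y] [u, v]
        = r * (\<Sum>h\<in>?G. coef f [x, y] [u, v])
          + r * (\<Sum>h\<in>?G. coef (coboundary Q op (Suc 0) (K h)) [x, y] [u, v])"
      by (simp only: dk coef_add coef_scale coef_sum)
    also have "\<dots> = r * (\<Sum>h\<in>?G. coef f [h x, h y] [h u, h v])"
      by (simp add: K(2) [OF _ Q] sum.distrib distrib_left)
    finally show ?thesis .
  qed
  have "invariant (f + coboundary Q op (Suc 0) k)"
    unfolding invariant_def
  proof (intro ballI)
    fix x y u v z
    assume Q: "x \<in> Q" "y \<in> Q" "u \<in> Q" "v \<in> Q" and z: "z \<in> Q"
    interpret G: group "Inn Q op"
      by (rule group_Inn)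
    let ?z = "right_translation Q op z"
    have z': "?z \<in> ?G"
      using z by (rule right_translation_Inn)
    have mult: "(h \<otimes>\<^bsub>Inn Q op\<^esub> ?z) a = h (a \<rhd> z)" if "h \<in> ?G" "a \<in> Q" for h a
      using that z z' by (simp add: Inn_mult rack_Aut_mult Inn_Aut)
    have "(\<Sum>h\<in>?G. coef f [h (x \<rhd> z), h (y \<rhd> z)] [h (u \<rhd> z), h (v \<rhd> z)])
        = (\<Sum>h\<in>?G. coef f [h x, h y] [h u, h v])"
      by (rule sum.reindex_bij_witness
          [of _ "\<lambda>h. h \<otimes>\<^bsub>Inn Q op\<^esub> inv\<^bsub>Inn Q op\<^esub> ?z" "\<lambda>h. h \<otimes>\<^bsub>Inn Q op\<^esub> ?z"])
        (use z' Q in \<open>simp_all add: G.m_assoc mult\<close>)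
    then show "coef (f + coboundary Q op (Suc 0) k) [x \<rhd> z, y \<rhd> z] [u \<rhd> z, v \<rhd> z]
        = coef (f + coboundary Q op (Suc 0) k) [x, y] [u, v]"
      using Q z by (simp only: average op_closed)
  qed
  moreover have "k \<in> cochains \<mm> Q (Suc 0)"
    unfolding k_def by (intro cochains_scale sum)
  ultimately show thesis
    using that by blast
qed

section \<open>Splitting invariant cocycles\<close>

lemma right_translation_eq_iff:
  "right_translation Q op z = right_translation Q op w \<longleftrightarrow> (\<forall>y\<in>Q. y \<rhd> z = y \<rhd> w)"
  by (auto simp: right_translation_def restrict_def fun_eq_iff)

lemma invariant_cocycle_equation:
  assumes "f \<in> cocycles \<mm> Q op 2" "invariant f"
    and "x \<in> Q" "y \<in> Q" "z \<in> Q" "u \<in> Q" "v \<in> Q" "w \<in> Q"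
  shows "(coef f [y, z] [v, w] when x \<rhd> y \<rhd> z = u \<rhd> v \<rhd> w) - (coef f [y, z] [v, w] when x = u)
    = (coef f [x, z] [u, w] when y \<rhd> z = v \<rhd> w) - (coef f [x \<rhd> y, z] [u \<rhd> v, w] when y = v)"
proof -
  have "(coef f [x \<rhd> z, y \<rhd> z] [u \<rhd> w, v \<rhd> w] when z = w) = (coef f [x, y] [u, v] when z = w)"
    using assms by (simp add: invariant_def when_def)
  then show ?thesis
    using cocycle_equation [OF assms(1,3-)] by (simp add: algebra_simps)
qed

text \<open>
  In the equation for invariant cocycles put the same letter \<open>y\<close> in the middle on both sides. If \<open>y\<close>
  separates \<open>z\<close> from \<open>w\<close>, one of the terms drops out and a single unknown coefficient is left, at
  the letters \<open>x' \<rhd> y\<close> and \<open>u' \<rhd> y\<close>, which are arbitrary.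
\<close>

lemma separated_coefs:
  assumes f: "f \<in> cocycles \<mm> Q op 2" "invariant f"
    and Q: "z \<in> Q" "w \<in> Q" "y \<in> Q" "x \<in> Q" "u \<in> Q" and sep: "y \<rhd> z \<noteq> y \<rhd> w"
  shows "coef f [x, z] [u, w]
    = (coef f [y, z] [y, w] when x = u) - (coef f [y, z] [y, w] when x \<rhd> z = u \<rhd> w)"
proof -
  obtain x' u' where x': "x' \<in> Q" "u' \<in> Q" "x' \<rhd> y = x" "u' \<rhd> y = u"
    using op_surj Q by metis
  have "x' = u' \<longleftrightarrow> x = u"
    using x' Q by auto
  with invariant_cocycle_equation [OF f x'(1) Q(3) Q(1) x'(2) Q(3) Q(2)] show ?thesis
    using sep by (simp add: x' algebra_simps)
qed

text \<open>
  Finiteness of the set of right translations is needed for the rows of \<open>g\<close>: the separating letter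
  depends on \<open>w\<close>, but it can be chosen to depend only on the right translation by \<open>w\<close>. For a fixed
  \<open>z\<close> only finitely many rows of \<open>f\<close> are then involved.
\<close>

lemma invariant_cocycle_splits:
  assumes f: "f \<in> cocycles \<mm> Q op 2" "invariant f" and fin: "finite (right_translation Q op ` Q)"
  obtains g where "g \<in> cochains \<mm> Q (Suc 0)"
    "f - coboundary Q op (Suc 0) g \<in> entropic_cochains \<mm> Q op 2"
proof -
  let ?\<rho> = "right_translation Q op"
  have f2: "f \<in> cochains \<mm> Q 2"
    using f by (simp add: cocycles_def)
  \<comment> \<open>A function of the two right translations, not of the letters: this keeps the rows of \<open>g\<close> finite.\<close>
  define sep where "sep r s = (SOME y. y \<in> Q \<and> r y \<noteq> s y)" for r s :: "'q \<Rightarrow> 'q"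
  have sep: "sep (?\<rho> z) (?\<rho> w) \<in> Q"
    "sep (?\<rho> z) (?\<rho> w) \<rhd> z \<noteq> sep (?\<rho> z) (?\<rho> w) \<rhd> w"
    if "?\<rho> z \<noteq> ?\<rho> w" for z w
  proof -
    have "\<exists>y. y \<in> Q \<and> ?\<rho> z y \<noteq> ?\<rho> w y"
      using that by (auto simp: right_translation_eq_iff)
    from someI_ex [OF this] show "sep (?\<rho> z) (?\<rho> w) \<in> Q"
      "sep (?\<rho> z) (?\<rho> w) \<rhd> z \<noteq> sep (?\<rho> z) (?\<rho> w) \<rhd> w"
      unfolding sep_def [symmetric] by auto
  qed
  define c where "c z w = (if ?\<rho> z = ?\<rho> w then 0
    else - coef f [sep (?\<rho> z) (?\<rho> w), z] [sep (?\<rho> z) (?\<rho> w), w])" for z w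
  \<comment> \<open>Every separating letter gives the same value: compare the two by putting one for \<open>x\<close> and \<open>u\<close>
    in the formula for the other.\<close>
  have c_sep: "c z w = - coef f [y, z] [y, w]"
    if Q: "z \<in> Q" "w \<in> Q" "y \<in> Q" and y: "y \<rhd> z \<noteq> y \<rhd> w" for z w y
  proof -
    have neq: "?\<rho> z \<noteq> ?\<rho> w"
      using y Q(3) by (auto simp: right_translation_eq_iff)
    show ?thesis
      using separated_coefs [OF f Q sep(1) [OF neq] sep(1) [OF neq] y] sep(2) [OF neq] neq
      by (simp add: c_def)
  qed
  obtain g where g: "g \<in> cochains \<mm> Q (Suc 0)"
    "\<And>z w. z \<in> Q \<Longrightarrow> w \<in> Q \<Longrightarrow> coef g [z] [w] = c z w"
  proof (rule cochain_1_with_coefs [of c])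
    fix z
    assume z: "z \<in> Q"
    show "finite {w \<in> Q. c z w \<noteq> 0}"
    proof (rule finite_subset)
      show "{w \<in> Q. c z w \<noteq> 0}
          \<subseteq> (\<Union>s\<in>?\<rho> ` Q. {w \<in> Q. coef f [sep (?\<rho> z) s, z] [sep (?\<rho> z) s, w] \<noteq> 0})"
        by (auto simp: c_def split: if_splits)
      show "finite (\<Union>s\<in>?\<rho> ` Q. {w \<in> Q. coef f [sep (?\<rho> z) s, z] [sep (?\<rho> z) s, w] \<noteq> 0})"
        by (intro finite_UN_I fin finite_coef_row) (simp add: inj_on_def)
    qed
    fix w
    show "c z w \<in> \<mm>"
    proof (cases "?\<rho> z = ?\<rho> w")
      case True
      then show ?thesis
        using ideal by (simp add: c_def ring_ideal_def)
    next
      case False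
      let ?y = "sep (?\<rho> z) (?\<rho> w)"
      have "coef f [?y, z] [?y, w] \<in> \<mm>"
        by (rule coef_in_ideal [OF f2]) (use sep(1) [OF False] z in \<open>simp add: words_2\<close>)
      from ideal_mult(1) [OF this, of "- 1"] show ?thesis
        using False by (simp add: c_def)
    qed
  qed (rule that)
  have same_trans: "?\<rho> (z \<rhd> t) = ?\<rho> (w \<rhd> t) \<longleftrightarrow> ?\<rho> z = ?\<rho> w"
    if "z \<in> Q" "w \<in> Q" "t \<in> Q" for z w t
  proof -
    have "(\<forall>y\<in>Q. y \<rhd> (z \<rhd> t) = y \<rhd> (w \<rhd> t)) \<longleftrightarrow> (\<forall>y\<in>Q. (y \<rhd> t) \<rhd> (z \<rhd> t) = (y \<rhd> t) \<rhd> (w \<rhd> t))"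
      using op_surj [OF _ that(3)] op_closed that by metis
    also have "\<dots> \<longleftrightarrow> (\<forall>y\<in>Q. y \<rhd> z = y \<rhd> w)"
      using that by (simp flip: op_dist)
    finally show ?thesis
      by (simp add: right_translation_eq_iff)
  qed
  \<comment> \<open>If \<open>y\<close> separates \<open>z\<close> from \<open>w\<close>, then \<open>y \<rhd> t\<close> separates \<open>z \<rhd> t\<close> from \<open>w \<rhd> t\<close>, and \<open>f\<close> is invariant.\<close>
  have c_inv: "c (z \<rhd> t) (w \<rhd> t) = c z w" if Q: "z \<in> Q" "w \<in> Q" "t \<in> Q" for z w t
  proof (cases "?\<rho> z = ?\<rho> w")
    case True
    then show ?thesis
      using same_trans [OF Q] by (simp add: c_def)
  next
    case False
    then obtain y where y: "y \<in> Q" "y \<rhd> z \<noteq> y \<rhd> w"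
      by (auto simp: right_translation_eq_iff)
    have "(y \<rhd> t) \<rhd> (z \<rhd> t) \<noteq> (y \<rhd> t) \<rhd> (w \<rhd> t)"
      using y Q by (simp flip: op_dist)
    then have "c (z \<rhd> t) (w \<rhd> t) = - coef f [y \<rhd> t, z \<rhd> t] [y \<rhd> t, w \<rhd> t]"
      using Q y by (intro c_sep) auto
    also have "\<dots> = c z w"
      using f(2) c_sep [OF Q(1,2) y] y Q by (simp add: invariant_def)
    finally show ?thesis .
  qed
  define e where "e = f - coboundary Q op (Suc 0) g"
  have e2: "e \<in> cochains \<mm> Q 2"
    using coboundary_in_cochains [OF g(1)] cochains_diff [OF f2] by (simp add: e_def numeral_2_eq_2)
  \<comment> \<open>Removing the coboundary deletes the coefficients whose last letters act differently and keeps
    the others.\<close>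
  have e: "coef e [x, z] [u, w] = (coef f [x, z] [u, w] when ?\<rho> z = ?\<rho> w)"
    if Q: "x \<in> Q" "z \<in> Q" "u \<in> Q" "w \<in> Q" for x z u w
  proof -
    have dg: "coef (coboundary Q op (Suc 0) g) [x, z] [u, w]
        = (c z w when x \<rhd> z = u \<rhd> w) - (c z w when x = u)"
      using Q by (cases "z = w") (simp_all add: coef_coboundary_1 g c_inv)
    show ?thesis
    proof (cases "?\<rho> z = ?\<rho> w")
      case True
      then show ?thesis
        by (simp add: e_def dg c_def)
    next
      case False
      then obtain y where y: "y \<in> Q" "y \<rhd> z \<noteq> y \<rhd> w"
        by (auto simp: right_translation_eq_iff)
      show ?thesis
        unfolding e_def coef_diff dg separated_coefs [OF f Q(2,4) y(1) Q(1,3) y(2)]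
          c_sep [OF Q(2,4) y]
        using False by (simp add: when_def)
    qed
  qed
  have "coef (partial_coboundary Q op 2 i e) [x, y, z] [u, v, w] = 0"
    if i: "i \<le> 2" and Q: "x \<in> Q" "y \<in> Q" "z \<in> Q" "u \<in> Q" "v \<in> Q" "w \<in> Q" for i x y z u v w
  proof -
    note eq = invariant_cocycle_equation [OF f Q]
    consider "i = 0" | "i = Suc 0" | "i = 2"
      using i by linarith
    then show ?thesis
    proof cases
      case 1
      show ?thesis
        unfolding 1 coef_partial_0 [OF e2 Q]
        using Q eq by (cases "y = v") (auto simp: e right_translation_eq_iff when_def split: if_splits)
    next
      case 2
      show ?thesis
        unfolding 2 coef_partial_1 [OF e2 Q]
        using Q eq by (auto simp: e right_translation_eq_iff when_def)
    next
      case 3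
      show ?thesis
        unfolding 3 coef_partial_2 [OF e2 Q]
        using Q f(2) by (simp add: e same_trans invariant_def when_def)
    qed
  qed
  then have "partial_coboundary Q op 2 i e = 0" if "i \<le> 2" for i
    using that
    by (intro cochain_eqI [OF partial_coboundary_in_cochains [OF e2] cochains_zero])
      (auto simp: words_3 numeral_3_eq_3 [symmetric])
  then have "e \<in> entropic_cochains \<mm> Q op 2"
    using e2 by (simp add: entropic_cochains_def)
  with g(1) show thesis
    using that unfolding e_def by blast
qed

section \<open>Entropic coboundaries vanish\<close>

text \<open>
  Being entropic makes \<open>b\<close> invariant under an action on the first letters alone, whereas a primitive
  exhibits \<open>b\<close> as a difference along the orbits of this action. Over a full period the differences
  add up to \<open>0\<close>, and a constant with vanishing multiple is \<open>0\<close> if the multiplier is invertible.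
\<close>

lemma entropic_coboundary_zero:
  assumes invertible: "order_invertible (Inn Q op) TYPE('a)"
    and k: "k \<in> cochains \<mm> Q (Suc 0)"
    and entropic: "coboundary Q op (Suc 0) k \<in> entropic_cochains \<mm> Q op 2"
  shows "coboundary Q op (Suc 0) k = 0"
proof -
  define b where "b = coboundary Q op (Suc 0) k"
  have b2: "b \<in> cochains \<mm> Q 2" and "partial_coboundary Q op 2 (Suc 0) b = 0"
    using entropic by (auto simp: entropic_cochains_def b_def)
  then have eq: "(coef b [x, z] [u, w] when y \<rhd> z = v \<rhd> w)
      = (coef b [x \<rhd> y, z] [u \<rhd> v, w] when y = v)"
    if "x \<in> Q" "y \<in> Q" "z \<in> Q" "u \<in> Q" "v \<in> Q" "w \<in> Q" for x y z u v w
    using coef_partial_1 [OF b2 that] by simp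
  have b: "coef b [x, z] [u, w] = 0" if Q: "x \<in> Q" "z \<in> Q" "u \<in> Q" "w \<in> Q" for x z u w
  proof (cases "\<forall>y\<in>Q. y \<rhd> z = y \<rhd> w")
    \<comment> \<open>A separating \<open>y\<close> makes one side of the entropy condition zero, and the other side is an
      arbitrary coefficient.\<close>
    case False
    then obtain y where y: "y \<in> Q" "y \<rhd> z \<noteq> y \<rhd> w"
      by blast
    obtain x' u' where "x' \<in> Q" "u' \<in> Q" "x' \<rhd> y = x" "u' \<rhd> y = u"
      using op_surj Q y(1) by metis
    then show ?thesis
      using eq [of x' y z u' y w] Q y by simp
  next
    case same: True
    show ?thesis
    proof (cases "z = w")
      case False
      then show ?thesis
        using Q same by (simp add: b_def coef_coboundary_1 k)
    next
      case True
      let ?r = "\<lambda>x. x \<rhd> z"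
      have iter: "(?r ^^ i) a \<in> Q" if "a \<in> Q" for a i
        using that Q by (induction i) auto
      have step: "coef b [a, z] [d, z] = coef k [?r a] [?r d] - coef k [a] [d]"
        if "a \<in> Q" "d \<in> Q" for a d
        using that Q by (simp add: b_def coef_coboundary_1 k)
      have const: "coef b [(?r ^^ i) x, z] [(?r ^^ i) u, z] = coef b [x, z] [u, z]" for i
      proof (induction i)
        case (Suc i)
        then show ?case
          using eq [of "(?r ^^ i) x" z z "(?r ^^ i) u" z z] Q iter by simp
      qed simp
      interpret G: group "Inn Q op"
        by (rule group_Inn)
      let ?N = "order (Inn Q op)"
      let ?\<rho> = "right_translation Q op z"
      have \<rho>: "?\<rho> \<in> carrier (Inn Q op)"
        using Q(2) by (rule right_translation_Inn)
      have pow: "(?\<rho> [^]\<^bsub>Inn Q op\<^esub> i) a = (?r ^^ i) a" if "a \<in> Q" for a and i :: nat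
      proof (induction i)
        case 0
        then show ?case
          using that by (simp add: Inn_one rack_Aut_one)
      next
        case (Suc i)
        have "?\<rho> [^]\<^bsub>Inn Q op\<^esub> Suc i = ?\<rho> \<otimes>\<^bsub>Inn Q op\<^esub> ?\<rho> [^]\<^bsub>Inn Q op\<^esub> i"
          using \<rho> by (rule G.nat_pow_Suc2)
        then show ?case
          using Suc that iter
          by (simp add: Inn_mult rack_Aut_mult Inn_Aut \<rho> G.nat_pow_closed)
      qed
      have period: "(?r ^^ ?N) a = a" if "a \<in> Q" for a
        using pow [OF that, of ?N] that by (simp add: G.pow_order_eq_1 [OF \<rho>] Inn_one rack_Aut_one)
      obtain r where r: "(\<Sum>i<?N. 1) * r = (1 :: 'a)"
        using invertible unfolding order_invertible_def by blast
      have "(\<Sum>i<?N. 1) * coef b [x, z] [u, z]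
          = (\<Sum>i<?N. coef b [(?r ^^ i) x, z] [(?r ^^ i) u, z])"
        by (simp only: const sum_distrib_right mult_1_left)
      also have "\<dots> = (\<Sum>i<?N. coef k [(?r ^^ Suc i) x] [(?r ^^ Suc i) u]
          - coef k [(?r ^^ i) x] [(?r ^^ i) u])"
        by (rule sum.cong) (simp_all add: step iter Q)
      also have "\<dots> = coef k [(?r ^^ ?N) x] [(?r ^^ ?N) u] - coef k [x] [u]"
        by (subst sum_lessThan_telescope) simp
      also have "\<dots> = 0"
        by (simp add: period Q)
      finally have "r * ((\<Sum>i<?N. 1) * coef b [x, z] [u, z]) = 0"
        by simp
      then have "coef b [x, z] [u, z] = 0"
        using r by (metis mult.assoc mult.commute mult_1_left)
      then show ?thesis
        using True by simp
    qed
  qed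
  have "b = 0"
    by (rule cochain_eqI [OF b2 cochains_zero]) (auto simp: words_2 b)
  then show ?thesis
    by (simp add: b_def)
qed

section \<open>The decomposition of the cocycles of degree two\<close>

lemma cocycle_decomposition:
  assumes invertible: "order_invertible (Inn Q op) TYPE('a)" and f: "f \<in> cocycles \<mm> Q op 2"
  obtains e b where "e \<in> entropic_cochains \<mm> Q op 2" "b \<in> coboundaries \<mm> Q op 2" "f = e + b"
proof -
  obtain k where k: "k \<in> cochains \<mm> Q (Suc 0)" "invariant (f + coboundary Q op (Suc 0) k)"
    by (rule cohomologous_invariant [OF invertible f])
  have "finite (right_translation Q op ` Q)"
    using invertible unfolding order_invertible_def
    by (metis finite_subset image_subsetI right_translation_Inn)
  moreover have "f + coboundary Q op (Suc 0) k \<in> cocycles \<mm> Q op 2"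
    by (intro cocycles_add f coboundary_cocycle k)
  ultimately obtain g where g: "g \<in> cochains \<mm> Q (Suc 0)"
    "f + coboundary Q op (Suc 0) k - coboundary Q op (Suc 0) g \<in> entropic_cochains \<mm> Q op 2"
    using invariant_cocycle_splits k(2) by metis
  have "coboundary Q op (Suc 0) g - coboundary Q op (Suc 0) k \<in> coboundaries \<mm> Q op 2"
    unfolding coboundaries_2
  proof
    have "g = (g - k) + k"
      by simp
    then have "coboundary Q op (Suc 0) g
        = coboundary Q op (Suc 0) (g - k) + coboundary Q op (Suc 0) k"
      using coboundary_add [OF cochains_diff [OF g(1) k(1)] k(1)] by metis
    then show "coboundary Q op (Suc 0) g - coboundary Q op (Suc 0) k = coboundary Q op (Suc 0) (g - k)"
      by (metis add_diff_cancel_right')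
  qed (rule cochains_diff [OF g(1) k(1)])
  with g(2) show thesis
    by (rule that) (simp add: algebra_simps)
qed

lemma entropic_inter_coboundaries:
  assumes "order_invertible (Inn Q op) TYPE('a)"
  shows "entropic_cochains \<mm> Q op 2 \<inter> coboundaries \<mm> Q op 2 = {0}"
proof -
  have "0 \<in> entropic_cochains \<mm> Q op 2" "0 \<in> coboundaries \<mm> Q op 2"
    using entropic_submodule [of 2] coboundaries_submodule by (auto simp: cochain_submodule_def)
  moreover have "f = 0" if "f \<in> entropic_cochains \<mm> Q op 2" "f \<in> coboundaries \<mm> Q op 2" for f
    using that entropic_coboundary_zero [OF assms] unfolding coboundaries_2 by blast
  ultimately show ?thesis
    by blast
qed

end

theorem theorem28:
  fixes \<mm> :: "'a::{comm_ring,comm_monoid_mult} set"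
    and Q :: "'q set"
    and op :: "'q \<Rightarrow> 'q \<Rightarrow> 'q"
  assumes "ring_ideal \<mm>"
    and "rack Q op"
  shows "(\<forall>n\<ge>1. cochain_submodule (entropic_cochains \<mm> Q op n) (cocycles \<mm> Q op n)) \<and>
    (order_invertible (Inn Q op) TYPE('a) \<longrightarrow>
      cochain_direct_sum (cocycles \<mm> Q op 2) (entropic_cochains \<mm> Q op 2) (coboundaries \<mm> Q op 2) \<and>
      (\<forall>f\<in>cocycles \<mm> Q op 2. \<exists>!e. e \<in> entropic_cochains \<mm> Q op 2 \<and> cohomologous \<mm> Q op 2 f e))"
proof -
  interpret rack_with_ideal \<mm> Q op
    by unfold_locales (fact assms)+
  have "cochain_direct_sum (cocycles \<mm> Q op 2) (entropic_cochains \<mm> Q op 2) (coboundaries \<mm> Q op 2)"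
    if invertible: "order_invertible (Inn Q op) TYPE('a)"
  proof -
    have "cocycles \<mm> Q op 2
        = {f + g |f g. f \<in> entropic_cochains \<mm> Q op 2 \<and> g \<in> coboundaries \<mm> Q op 2}"
    proof (intro equalityI subsetI)
      fix f
      assume "f \<in> cocycles \<mm> Q op 2"
      then show "f \<in> {f + g |f g. f \<in> entropic_cochains \<mm> Q op 2 \<and> g \<in> coboundaries \<mm> Q op 2}"
        using cocycle_decomposition [OF invertible] by blast
    next
      fix f
      assume "f \<in> {f + g |f g. f \<in> entropic_cochains \<mm> Q op 2 \<and> g \<in> coboundaries \<mm> Q op 2}"
      then show "f \<in> cocycles \<mm> Q op 2"
        using entropic_submodule [of 2] coboundaries_submodule
        by (auto simp: cochain_submodule_def intro!: cocycles_add)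
    qed
    then show ?thesis
      using entropic_submodule [of 2] coboundaries_submodule
        entropic_inter_coboundaries [OF invertible]
      by (simp add: cochain_direct_sum_def)
  qed
  then show ?thesis
    unfolding cohomologous_def using entropic_submodule direct_sum_unique_component by blast
qed

end
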